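(* The difference-reflection representation $h\mapsto\hat{T}(h)$ ($h\in\mathbb{H}$) restricts to a unitary representation of the affine Hecke algebra $H\subset\mathbb{H}$ into the space of bounded operators on $l^2(\mathbb{Z},\delta)$; i.e. for every $h\in H$ the operator $\hat T(h)$ restricts to a bounded operator on $l^2(\mathbb{Z},\delta)$, and $$\langle \hat T(h)f,g\rangle_\delta=\langle f,\hat T(h^* )g\rangle_\delta\qquad (h\in H,\ f,g\in l^2(\mathbb{Z},\delta)).$$
   Context: Fix $\tau\in(0,1)$ and an integer $M>1$. The double affine Hecke algebra $\mathbb{H}$ (type $A_1$, $q=1$) is the complex unital associative algebra generated by invertible elements $T,U,X$ subject to $(T-\tau)(T+\tau^{-1})=0$, $U^2=1$, $UXU=X^{-1}=T^{-1}XT^{-1}$; the affine Hecke algebra is the subalgebra $H:=\langle T,U\rangle\subset\mathbb{H}$. Affine Weyl group: $W=\langle s,u\mid s^2=u^2=1\rangle$, $s_1:=s$, $s_0:=usu$, $W_S:=\langle s_0,s_1\rangle$. Every $w\in W$ can be written uniquely as $w=u^{i_0}s_{i_1}\cdots s_{i_r}$ with $i_j\in\{0,1\}$ and $r\ge 0$ minimal; $\ell(w):=r$ and $T_w:=U^{i_0}T_{i_1}\cdots T_{i_r}$ with $T_1:=T$, $T_0:=UTU$. The elements $T_w$, $w\in W$, form a linear basis of $H$. The map $T_w\mapsto T_w^*:=T_{w^{-1}}$ extends to an antilinear anti-involution $*$ of $H$. $\mathcal{C}(\mathbb{Z})$ is the space of functions $f:\mathbb{Z}\to\mathbb{C}$,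 with $f_n:=f(n)$. $W$ acts on $\mathbb{Z}$ by $sn=-n$, $un=M-n$ and on $\mathcal{C}(\mathbb{Z})$ by $(wf)(n)=f(w^{-1}n)$. For $n\in\mathbb{Z}$, $w_n$ denotes the unique shortest element of $W_S$ mapping $n$ into $\Lambda_M:=\{0,1,\dots,M\}$. On $H$ the difference-reflection representation $h\mapsto\hat T(h)$ on $\mathcal{C}(\mathbb{Z})$ is determined by $T\mapsto\hat T$, $U\mapsto u$, where $(\hat Tf)_n=\tau f_{-n}$ if $n\ge0$ and $(\hat Tf)_n=\tau^{-1}f_{-n}+(\tau-\tau^{-1})f_n$ if $n<0$, and $(uf)_n=f_{M-n}$. $l^2(\mathbb{Z},\delta)\subset\mathcal{C}(\mathbb{Z})$ is the Hilbert space determined by the inner product $\langle f,g\rangle_\delta:=\sum_{n\in\mathbb{Z}}f_n\overline{g_n}\,\delta_n$ with $\delta_n:=\tau^{2\ell(w_n)}$. *)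

theory Defs
  imports
    "HOL-Analysis.Infinite_Sum"
    "HOL-Algebra.Algebra"
    "HOL-Algebra.Algebraic_Closure_Type"
    "HOL-Library.Poly_Mapping"
    "HOL-Library.FuncSet"
begin

section \<open>The double affine Hecke algebra\<close>

text \<open>
  Words over an alphabet, with concatenation written additively: the finitely supported functions
  from words to the complex numbers with their convolution product are then the free associative
  algebra.
\<close>

datatype 'a fword = FWord "'a list"

instantiation fword :: (type) monoid_add
begin

definition zero_fword :: "'a fword" where "0 = FWord []"

fun plus_fword :: "'a fword \<Rightarrow> 'a fword \<Rightarrow> 'a fword" where
  "FWord xs + FWord ys = FWord (xs @ ys)"

instance
proof
  fix a b c :: "'a fword"
  show "a + b + c = a + (b + c)" by (cases a; cases b; cases c) simp
  show "0 + a = a" by (cases a) (simp add: zero_fword_def)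
  show "a + 0 = a" by (cases a) (simp add: zero_fword_def)
qed

end

datatype daha_gen = GT | GU | GX
datatype daha_letter = Gen daha_gen | Gen_Inv daha_gen

type_synonym daha_free = "daha_letter fword \<Rightarrow>\<^sub>0 complex"

definition free_letter :: "daha_letter \<Rightarrow> daha_free" where
  "free_letter a = Poly_Mapping.single (FWord [a]) 1"

definition free_scalar :: "complex \<Rightarrow> daha_free" where
  "free_scalar c = Poly_Mapping.single 0 c"

definition daha_relators :: "real \<Rightarrow> daha_free set" where
  "daha_relators \<tau> =
     (let t = free_letter (Gen GT); ti = free_letter (Gen_Inv GT);
          u = free_letter (Gen GU);
          x = free_letter (Gen GX); xi = free_letter (Gen_Inv GX)
      in (\<Union>g. {free_letter (Gen g) * free_letter (Gen_Inv g) - 1,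
                free_letter (Gen_Inv g) * free_letter (Gen g) - 1})
         \<union> {(t - free_scalar (of_real \<tau>)) * (t + free_scalar (inverse (of_real \<tau>))),
            u * u - 1,
            u * x * u - xi,
            xi - ti * x * ti})"

definition daha :: "real \<Rightarrow> daha_free set ring" where
  "daha \<tau> = ring_of_type_algebra Quot (Idl\<^bsub>ring_of_type_algebra\<^esub> (daha_relators \<tau>))"

definition daha_class :: "real \<Rightarrow> daha_free \<Rightarrow> daha_free set" where
  "daha_class \<tau> p =
     Idl\<^bsub>ring_of_type_algebra\<^esub> (daha_relators \<tau>) +>\<^bsub>ring_of_type_algebra\<^esub> p"

text \<open>
  The complex scalars enter as the central elements \<open>daha_scalar \<tau> c\<close>; the scalar multiple
  of \<open>h\<close> by \<open>c\<close> is \<open>daha_scalar \<tau> c \<otimes> h\<close>.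
\<close>

definition daha_scalar :: "real \<Rightarrow> complex \<Rightarrow> daha_free set" where
  "daha_scalar \<tau> c = daha_class \<tau> (free_scalar c)"

definition daha_T :: "real \<Rightarrow> daha_free set" where
  "daha_T \<tau> = daha_class \<tau> (free_letter (Gen GT))"

definition daha_U :: "real \<Rightarrow> daha_free set" where
  "daha_U \<tau> = daha_class \<tau> (free_letter (Gen GU))"

text \<open>The unital complex subalgebra generated by \<open>T\<close> and \<open>U\<close>.\<close>

definition affine_hecke :: "real \<Rightarrow> daha_free set set" where
  "affine_hecke \<tau> = generate_ring (daha \<tau>) (range (daha_scalar \<tau>) \<union> {daha_T \<tau>, daha_U \<tau>})"


section \<open>The affine Weyl group\<close>

datatype weyl_gen = Refl_s | Flip_u

inductive weyl_eq :: "weyl_gen list \<Rightarrow> weyl_gen list \<Rightarrow> bool" where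
  cancel: "weyl_eq (xs @ [a, a] @ ys) (xs @ ys)"
| refl: "weyl_eq xs xs"
| sym: "weyl_eq xs ys \<Longrightarrow> weyl_eq ys xs"
| trans: "weyl_eq xs ys \<Longrightarrow> weyl_eq ys zs \<Longrightarrow> weyl_eq xs zs"

lemma weyl_eq_append_left: "weyl_eq xs ys \<Longrightarrow> weyl_eq (zs @ xs) (zs @ ys)"
proof (induction rule: weyl_eq.induct)
  case (cancel xs a ys)
  show ?case using weyl_eq.cancel[of "zs @ xs" a ys] by simp
qed (auto intro: weyl_eq.intros)

lemma weyl_eq_append_right: "weyl_eq xs ys \<Longrightarrow> weyl_eq (xs @ zs) (ys @ zs)"
proof (induction rule: weyl_eq.induct)
  case (cancel xs a ys)
  show ?case using weyl_eq.cancel[of xs a "ys @ zs"] by simp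
qed (auto intro: weyl_eq.intros)

lemma weyl_eq_rev: "weyl_eq xs ys \<Longrightarrow> weyl_eq (rev xs) (rev ys)"
proof (induction rule: weyl_eq.induct)
  case (cancel xs a ys)
  show ?case using weyl_eq.cancel[of "rev ys" a "rev xs"] by simp
qed (auto intro: weyl_eq.intros)

quotient_type weyl = "weyl_gen list" / weyl_eq
  by (rule equivpI) (auto simp: reflp_def symp_def transp_def intro: weyl_eq.intros)

instantiation weyl :: monoid_mult
begin

lift_definition one_weyl :: weyl is "[]" .

lift_definition times_weyl :: "weyl \<Rightarrow> weyl \<Rightarrow> weyl" is "(@)"
  by (meson weyl_eq.trans weyl_eq_append_left weyl_eq_append_right)

instance
  by standard (transfer; simp add: weyl_eq.refl)+

end

lift_definition weyl_s :: weyl is "[Refl_s]" .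
lift_definition weyl_u :: weyl is "[Flip_u]" .

text \<open>The generators are involutions, so reversing a word inverts the element it represents.\<close>

lift_definition weyl_inv :: "weyl \<Rightarrow> weyl" is rev
  by (rule weyl_eq_rev)

lemma weyl_s_s: "weyl_s * weyl_s = 1"
  by transfer (use weyl_eq.cancel[of "[]" Refl_s "[]"] in simp)

lemma weyl_u_u: "weyl_u * weyl_u = 1"
  by transfer (use weyl_eq.cancel[of "[]" Flip_u "[]"] in simp)

lemma weyl_inv_left: "weyl_inv w * w = 1"
proof transfer
  fix xs
  show "weyl_eq (rev xs @ xs) []"
  proof (induction xs)
    case (Cons x xs)
    then show ?case
      using weyl_eq.cancel[of "rev xs" x xs] by (auto intro: weyl_eq.trans)
  qed (simp add: weyl_eq.refl)
qed

lemma weyl_inv_right: "w * weyl_inv w = 1"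
proof -
  have "weyl_inv (weyl_inv w) = w" by transfer (simp add: weyl_eq.refl)
  then show ?thesis using weyl_inv_left[of "weyl_inv w"] by simp
qed

definition weyl_refl :: "nat \<Rightarrow> weyl" where
  "weyl_refl j = (if j = 0 then weyl_u * weyl_s * weyl_u else weyl_s)"

definition weyl_S :: "weyl set" where
  "weyl_S = {prod_list (map weyl_refl js) | js. set js \<subseteq> {0, 1}}"

definition weyl_expr :: "weyl \<Rightarrow> nat \<Rightarrow> nat list \<Rightarrow> bool" where
  "weyl_expr w i js \<longleftrightarrow>
     i \<in> {0, 1} \<and> set js \<subseteq> {0, 1} \<and> w = weyl_u ^ i * prod_list (map weyl_refl js)"

definition weyl_length :: "weyl \<Rightarrow> nat" where
  "weyl_length w = (LEAST r. \<exists>i js. weyl_expr w i js \<and> length js = r)"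

definition weyl_reduced :: "weyl \<Rightarrow> nat \<times> nat list" where
  "weyl_reduced w = (THE p. weyl_expr w (fst p) (snd p) \<and> length (snd p) = weyl_length w)"

fun weyl_gen_act :: "int \<Rightarrow> weyl_gen \<Rightarrow> int \<Rightarrow> int" where
  "weyl_gen_act M Refl_s n = - n"
| "weyl_gen_act M Flip_u n = M - n"

lift_definition weyl_act :: "int \<Rightarrow> weyl \<Rightarrow> int \<Rightarrow> int" is
  "\<lambda>M. foldr (weyl_gen_act M)"
proof -
  fix M :: int and xs ys
  assume "weyl_eq xs ys"
  then show "foldr (weyl_gen_act M) xs = foldr (weyl_gen_act M) ys"
  proof (induction rule: weyl_eq.induct)
    case (cancel xs a ys)
    show ?case by (cases a) (simp_all add: fun_eq_iff)
  qed auto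
qed

definition weyl_shortest :: "int \<Rightarrow> int \<Rightarrow> weyl" where
  "weyl_shortest M n =
     (THE w. w \<in> weyl_S \<and> weyl_act M w n \<in> {0..M} \<and>
        (\<forall>v \<in> weyl_S. weyl_act M v n \<in> {0..M} \<longrightarrow> weyl_length w \<le> weyl_length v))"


section \<open>The basis elements and the anti-involution\<close>

definition hecke_refl :: "real \<Rightarrow> nat \<Rightarrow> daha_free set" where
  "hecke_refl \<tau> j =
     (if j = 0 then daha_U \<tau> \<otimes>\<^bsub>daha \<tau>\<^esub> daha_T \<tau> \<otimes>\<^bsub>daha \<tau>\<^esub> daha_U \<tau> else daha_T \<tau>)"

definition hecke_basis :: "real \<Rightarrow> weyl \<Rightarrow> daha_free set" where
  "hecke_basis \<tau> w =
     daha_U \<tau> [^]\<^bsub>daha \<tau>\<^esub> fst (weyl_reduced w) \<otimes>\<^bsub>daha \<tau>\<^esub>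
     foldr (\<lambda>j h. hecke_refl \<tau> j \<otimes>\<^bsub>daha \<tau>\<^esub> h) (snd (weyl_reduced w)) \<one>\<^bsub>daha \<tau>\<^esub>"

definition is_hecke_star :: "real \<Rightarrow> (daha_free set \<Rightarrow> daha_free set) \<Rightarrow> bool" where
  "is_hecke_star \<tau> \<sigma> \<longleftrightarrow>
     \<sigma> \<in> affine_hecke \<tau> \<rightarrow>\<^sub>E affine_hecke \<tau> \<and>
     (\<forall>h \<in> affine_hecke \<tau>. \<forall>k \<in> affine_hecke \<tau>.
        \<sigma> (h \<oplus>\<^bsub>daha \<tau>\<^esub> k) = \<sigma> h \<oplus>\<^bsub>daha \<tau>\<^esub> \<sigma> k \<and>
        \<sigma> (h \<otimes>\<^bsub>daha \<tau>\<^esub> k) = \<sigma> k \<otimes>\<^bsub>daha \<tau>\<^esub> \<sigma> h) \<and>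
     (\<forall>h \<in> affine_hecke \<tau>. \<forall>c.
        \<sigma> (daha_scalar \<tau> c \<otimes>\<^bsub>daha \<tau>\<^esub> h) = daha_scalar \<tau> (cnj c) \<otimes>\<^bsub>daha \<tau>\<^esub> \<sigma> h) \<and>
     (\<forall>h \<in> affine_hecke \<tau>. \<sigma> (\<sigma> h) = h) \<and>
     (\<forall>w. \<sigma> (hecke_basis \<tau> w) = hecke_basis \<tau> (weyl_inv w))"

text \<open>
  There is exactly one such map: reversing words and conjugating coefficients preserves the
  relations, and the basis elements span.
\<close>

definition hecke_star :: "real \<Rightarrow> daha_free set \<Rightarrow> daha_free set" where
  "hecke_star \<tau> = (THE \<sigma>. is_hecke_star \<tau> \<sigma>)"


section \<open>The difference-reflection representation\<close>

type_synonym lattice_fun = "int \<Rightarrow> complex"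

text \<open>A unital representation of the affine Hecke algebra on the space \<open>V\<close> of lattice functions.\<close>

definition hecke_rep_on ::
  "real \<Rightarrow> lattice_fun set \<Rightarrow> (daha_free set \<Rightarrow> lattice_fun \<Rightarrow> lattice_fun) \<Rightarrow> bool" where
  "hecke_rep_on \<tau> V \<rho> \<longleftrightarrow>
     (\<forall>h \<in> affine_hecke \<tau>. \<forall>f \<in> V. \<rho> h f \<in> V) \<and>
     (\<forall>h \<in> affine_hecke \<tau>. \<forall>f \<in> V. \<forall>g \<in> V. \<forall>c d.
        \<rho> h (\<lambda>n. c * f n + d * g n) = (\<lambda>n. c * \<rho> h f n + d * \<rho> h g n)) \<and>
     (\<forall>h \<in> affine_hecke \<tau>. \<forall>k \<in> affine_hecke \<tau>. \<forall>f \<in> V.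
        \<rho> (h \<oplus>\<^bsub>daha \<tau>\<^esub> k) f = (\<lambda>n. \<rho> h f n + \<rho> k f n) \<and>
        \<rho> (h \<otimes>\<^bsub>daha \<tau>\<^esub> k) f = \<rho> h (\<rho> k f)) \<and>
     (\<forall>c. \<forall>f \<in> V. \<rho> (daha_scalar \<tau> c) f = (\<lambda>n. c * f n))"

definition diffrefl_T :: "real \<Rightarrow> lattice_fun \<Rightarrow> lattice_fun" where
  "diffrefl_T \<tau> f n =
     (if n \<ge> 0 then of_real \<tau> * f (- n)
      else of_real (inverse \<tau>) * f (- n) + of_real (\<tau> - inverse \<tau>) * f n)"

definition diffrefl_U :: "int \<Rightarrow> lattice_fun \<Rightarrow> lattice_fun" where
  "diffrefl_U M f n = f (M - n)"

definition is_diffrefl_rep ::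
  "real \<Rightarrow> int \<Rightarrow> (daha_free set \<Rightarrow> lattice_fun \<Rightarrow> lattice_fun) \<Rightarrow> bool" where
  "is_diffrefl_rep \<tau> M \<rho> \<longleftrightarrow>
     \<rho> \<in> extensional (affine_hecke \<tau>) \<and> hecke_rep_on \<tau> UNIV \<rho> \<and>
     \<rho> (daha_T \<tau>) = diffrefl_T \<tau> \<and> \<rho> (daha_U \<tau>) = diffrefl_U M"

text \<open>
  Uniqueness is clear. For existence one needs that no relation of the double affine Hecke algebra
  among \<open>T\<close> and \<open>U\<close> is violated by the two operators: with \<open>t\<close>, \<open>u\<close> denoting these operators,
  \<open>T = (t, - u t\<^sup>-\<^sup>1 u)\<close>, \<open>U = (u, - u)\<close> and \<open>X = U V\<close>, \<open>V\<close> the swap, satisfy all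
  relations on two copies of the space.
\<close>

definition diffrefl_rep :: "real \<Rightarrow> int \<Rightarrow> daha_free set \<Rightarrow> lattice_fun \<Rightarrow> lattice_fun" where
  "diffrefl_rep \<tau> M = (THE \<rho>. is_diffrefl_rep \<tau> M \<rho>)"


section \<open>The Hilbert space\<close>

definition delta_weight :: "real \<Rightarrow> int \<Rightarrow> int \<Rightarrow> real" where
  "delta_weight \<tau> M n = \<tau> ^ (2 * weyl_length (weyl_shortest M n))"

definition l2_delta :: "real \<Rightarrow> int \<Rightarrow> lattice_fun set" where
  "l2_delta \<tau> M = {f. (\<lambda>n. (cmod (f n))\<^sup>2 * delta_weight \<tau> M n) summable_on UNIV}"

definition inner_delta :: "real \<Rightarrow> int \<Rightarrow> lattice_fun \<Rightarrow> lattice_fun \<Rightarrow> complex" where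
  "inner_delta \<tau> M f g = (\<Sum>\<^sub>\<infinity>n. f n * cnj (g n) * of_real (delta_weight \<tau> M n))"

definition norm_delta :: "real \<Rightarrow> int \<Rightarrow> lattice_fun \<Rightarrow> real" where
  "norm_delta \<tau> M f = sqrt (Re (inner_delta \<tau> M f f))"

end

theory Submission
  imports Defs
begin

text \<open>
  The operator of \<open>T\<close> combines the reflection \<open>n \<mapsto> - n\<close> with multiplication operators, and \<open>U\<close> acts
  by the reflection \<open>n \<mapsto> M - n\<close>. Since \<open>\<delta>\<close> satisfies \<open>\<delta>\<^bsub>-n\<^esub> = \<tau>\<^sup>2 \<delta>\<^bsub>n\<^esub>\<close> for \<open>n > 0\<close> and
  \<open>\<delta>\<^bsub>M-n\<^esub> = \<delta>\<^bsub>n\<^esub>\<close>, both are bounded and self-adjoint, and these properties pass from the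
  generators to all of \<open>H\<close>. The identities for \<open>\<delta>\<close> hold because \<open>\<ell>(w)\<close> is the distance of the alcove
  \<open>w(0, 1)\<close> from the fundamental alcove in the realisation of \<open>W\<close> with \<open>M = 1\<close>.

  That the anti-involution and the representation exist at all is shown on the free algebra:
  reversing words and conjugating coefficients preserves the relators, and the two operators on
  lattice functions extend to an action of the whole double affine Hecke algebra on two copies of
  the space, whose first copy is stable under \<open>H\<close>.
\<close>

section \<open>The affine Weyl group acting on alcoves\<close>

lemma weyl_act_mult: "weyl_act M (v * w) n = weyl_act M v (weyl_act M w n)"
  by transfer simp

lemma weyl_act_one [simp]: "weyl_act M 1 n = n"
  by transfer simp

lemma weyl_act_s [simp]: "weyl_act M weyl_s n = - n"
  by transfer simp

lemma weyl_act_u [simp]: "weyl_act M weyl_u n = M - n"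
  by transfer simp

lemma weyl_s_s_mult [simp]: "weyl_s * (weyl_s * w) = w"
  by (metis mult.assoc mult_1 weyl_s_s)

lemma weyl_u_u_mult [simp]: "weyl_u * (weyl_u * w) = w"
  by (metis mult.assoc mult_1 weyl_u_u)

lemma weyl_refl_refl_mult [simp]: "weyl_refl j * (weyl_refl j * w) = w"
  by (simp add: weyl_refl_def mult.assoc)

lemma abs_weyl_induct:
  assumes "P 1" and "\<And>w. P w \<Longrightarrow> P (weyl_s * w)" and "\<And>w. P w \<Longrightarrow> P (weyl_u * w)"
  shows "P (abs_weyl xs)"
proof (induction xs)
  case Nil
  then show ?case using assms(1) by (simp add: one_weyl_def)
next
  case (Cons a xs)
  have "abs_weyl (a # xs) = (case a of Refl_s \<Rightarrow> weyl_s | Flip_u \<Rightarrow> weyl_u) * abs_weyl xs"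
    by (cases a) (simp_all add: weyl_s_def weyl_u_def times_weyl.abs_eq)
  then show ?case using Cons assms by (cases a) auto
qed

lemma weyl_induct [case_names one s u]:
  assumes "P 1" and "\<And>w. P w \<Longrightarrow> P (weyl_s * w)" and "\<And>w. P w \<Longrightarrow> P (weyl_u * w)"
  shows "P w"
  using abs_weyl_induct[OF assms, of "rep_weyl w"]
  by (simp add: Quotient3_abs_rep[OF Quotient3_weyl])

text \<open>The alcove \<open>w(0, 1)\<close> for \<open>M = 1\<close>, represented by its left end.\<close>

definition alcove :: "weyl \<Rightarrow> int" where
  "alcove w = min (weyl_act 1 w 0) (weyl_act 1 w 1)"

text \<open>Both generators act as isometries, so neighbouring points stay neighbours.\<close>

lemma alcove_ends: "\<bar>weyl_act 1 w 1 - weyl_act 1 w 0\<bar> = 1"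
  by (induction w rule: weyl_induct) (auto simp: weyl_act_mult)

text \<open>Each generator has slope -1 and a translation part proportional to M, so the action for
  any M can be read off from the one with M = 1.\<close>

lemma weyl_act_affine:
  "weyl_act M w n = (weyl_act 1 w 1 - weyl_act 1 w 0) * n + M * weyl_act 1 w 0"
  by (induction w rule: weyl_induct) (auto simp: weyl_act_mult algebra_simps)

lemma alcove_one [simp]: "alcove 1 = 0"
  by (simp add: alcove_def)

text \<open>The generators reverse orientation, so the new left end is the image of the old right
  end.\<close>

lemma alcove_s: "alcove (weyl_s * w) = - alcove w - 1"
  unfolding alcove_def weyl_act_mult weyl_act_s weyl_act_u using alcove_ends[of w] by linarith

lemma alcove_u: "alcove (weyl_u * w) = - alcove w"
  unfolding alcove_def weyl_act_mult weyl_act_s weyl_act_u using alcove_ends[of w] by linarith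

lemma alcove_refl: "alcove (weyl_refl j * w) = (if j = 0 then 1 - alcove w else - alcove w - 1)"
  by (simp add: weyl_refl_def alcove_s alcove_u mult.assoc)

section \<open>Word length as distance from the fundamental alcove\<close>

lemma alcove_u_power: "\<bar>alcove (weyl_u ^ i * w)\<bar> = \<bar>alcove w\<bar>"
  by (induction i) (auto simp: alcove_u mult.assoc)

lemma weyl_u_power_cancel [simp]: "weyl_u ^ i * (weyl_u ^ i * w) = w"
proof (induction i)
  case (Suc i)
  have "weyl_u ^ Suc i * (weyl_u ^ Suc i * w) = weyl_u ^ i * (weyl_u * (weyl_u * (weyl_u ^ i * w)))"
    by (metis mult.assoc power_Suc power_Suc2)
  then show ?case using Suc by simp
qed simp

text \<open>For M = 1 the letters 0 and 1 are the reflections at 1 and at 0, the ends of the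
  fundamental alcove; each changes the distance from it by one.\<close>

lemma alcove_le_length: "\<bar>alcove (prod_list (map weyl_refl js))\<bar> \<le> int (length js)"
  by (induction js) (auto simp: alcove_refl)

lemma weyl_expr_alcove_le: "weyl_expr w i js \<Longrightarrow> \<bar>alcove w\<bar> \<le> int (length js)"
  unfolding weyl_expr_def using alcove_le_length[of js] by (auto simp: alcove_u_power)

text \<open>At a nonzero index one reflection increases the distance and the other decreases it.
  Hence prepending a letter to a minimal word either cancels its first letter or gives a minimal
  word again.\<close>

lemma weyl_expr_minimal_exists:
  "\<exists>i js. weyl_expr w i js \<and> int (length js) = \<bar>alcove w\<bar>"
proof (induction w rule: weyl_induct)
  case one
  have "weyl_expr 1 0 []" by (simp add: weyl_expr_def)
  then show ?case by fastforce
next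
  case (u w)
  then obtain i js where e: "weyl_expr w i js" and l: "int (length js) = \<bar>alcove w\<bar>" by blast
  have "weyl_expr (weyl_u * w) (1 - i) js"
    using e by (auto simp: weyl_expr_def)
  then show ?case using l by (auto simp: alcove_u)
next
  case (s w)
  then obtain i js where e: "weyl_expr w i js" and l: "int (length js) = \<bar>alcove w\<bar>" by blast
  \<comment> \<open>Conjugation by u exchanges the two reflections, so
    \<open>weyl_s * weyl_u ^ i\<close> equals \<open>weyl_u ^ i * weyl_refl j\<close>.\<close>
  define j where "j = 1 - i"
  define x where "x = prod_list (map weyl_refl js)"
  have i: "i = 0 \<or> i = 1" and js: "set js \<subseteq> {0, 1}" and w: "w = weyl_u ^ i * x"
    using e by (auto simp: weyl_expr_def x_def)
  have sw: "weyl_s * w = weyl_u ^ i * (weyl_refl j * x)"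
    using i by (auto simp: w j_def weyl_refl_def mult.assoc)
  have lx: "int (length js) = \<bar>alcove x\<bar>" using l by (simp add: w alcove_u_power)
  have lsw: "\<bar>alcove (weyl_s * w)\<bar> = \<bar>alcove (weyl_refl j * x)\<bar>" by (simp add: sw alcove_u_power)
  have "weyl_expr (weyl_s * w) i (j # js)"
    using i js by (auto simp: weyl_expr_def sw x_def j_def)
  show ?case
  proof (cases js)
    case Nil
    then show ?thesis using \<open>weyl_expr (weyl_s * w) i (j # js)\<close> lx lsw
      by (intro exI[of _ i] exI[of _ "[j]"]) (auto simp: alcove_refl)
  next
    case (Cons j' js')
    have tl: "weyl_refl j' * x = prod_list (map weyl_refl js')" by (simp add: x_def Cons)
    \<comment> \<open>Removing the first letter of a minimal word lowers the distance, which decides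
      on which side of the fundamental alcove x lies.\<close>
    then have le: "\<bar>alcove (weyl_refl j' * x)\<bar> \<le> int (length js')"
      using alcove_le_length by metis
    show ?thesis
    proof (cases "j' = j")
      case True
      then have "weyl_expr (weyl_s * w) i js'"
        using i js tl sw by (auto simp: weyl_expr_def Cons)
      then show ?thesis using le lx lsw True Cons
        by (intro exI[of _ i] exI[of _ "js'"]) (auto simp: alcove_refl split: if_splits)
    next
      case False
      \<comment> \<open>The reflection other than the first letter leads further away, so the longer
        word is minimal.\<close>
      then have "(j = 0 \<and> j' \<noteq> 0) \<or> (j \<noteq> 0 \<and> j' = 0)" using js Cons i by (auto simp: j_def)
      then show ?thesis using le lx lsw \<open>weyl_expr (weyl_s * w) i (j # js)\<close> Cons
        by (intro exI[of _ i] exI[of _ "j # js"]) (auto simp: alcove_refl split: if_splits)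
    qed
  qed
qed

text \<open>Minimal words attain the lower bound \<open>weyl_expr_alcove_le\<close>.\<close>

lemma weyl_length_eq: "int (weyl_length w) = \<bar>alcove w\<bar>"
proof -
  obtain i js where e: "weyl_expr w i js" "int (length js) = \<bar>alcove w\<bar>"
    using weyl_expr_minimal_exists by blast
  have "weyl_length w = length js"
    unfolding weyl_length_def
  proof (rule Least_equality)
    show "length js \<le> y" if "\<exists>i js. weyl_expr w i js \<and> length js = y" for y
      using that weyl_expr_alcove_le e(2) by fastforce
  qed (use e in blast)
  then show ?thesis using e by simp
qed

section \<open>Uniqueness of reduced expressions\<close>

lemma even_weyl_refl: "even (weyl_act 1 (prod_list (map weyl_refl js)) n) \<longleftrightarrow> even n"
  by (induction js) (auto simp: weyl_act_mult weyl_refl_def)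

text \<open>For M = 1 the reflections are -x and 2 - x and preserve parity, while u changes it; the
  image of 0 therefore reveals the exponent of u.\<close>

lemma weyl_expr_parity: "weyl_expr w i js \<Longrightarrow> i = (if even (weyl_act 1 w 0) then 0 else 1)"
  by (auto simp: weyl_expr_def weyl_act_mult even_weyl_refl)

text \<open>The first letter is forced, being the only reflection that brings the alcove nearer;
  cancelling it gives the induction.\<close>

lemma minimal_word_unique:
  assumes "prod_list (map weyl_refl js) = prod_list (map weyl_refl ks)"
    and "set js \<subseteq> {0, 1}" "set ks \<subseteq> {0, 1}"
    and "length ks = length js" "int (length js) = \<bar>alcove (prod_list (map weyl_refl js))\<bar>"
  shows "js = ks"
  using assms
proof (induction js arbitrary: ks)
  case (Cons j js)
  then obtain k ks' where ks: "ks = k # ks'" by (cases ks) auto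
  define x where "x = prod_list (map weyl_refl (j # js))"
  have xk: "x = prod_list (map weyl_refl (k # ks'))" using Cons.prems ks x_def by simp
  have j: "weyl_refl j * x = prod_list (map weyl_refl js)" by (simp add: x_def)
  have k: "weyl_refl k * x = prod_list (map weyl_refl ks')" by (simp add: xk)
  have le: "\<bar>alcove (weyl_refl j * x)\<bar> \<le> int (length js)" "\<bar>alcove (weyl_refl k * x)\<bar> \<le> int (length js)"
    using j k alcove_le_length[of js] alcove_le_length[of ks'] Cons.prems(4) ks by auto
  have l: "int (length js) + 1 = \<bar>alcove x\<bar>" using Cons.prems(5) x_def by simp
  \<comment> \<open>Letter 0 lowers the distance only at a positive index and letter 1 only at a
    negative one, so different first letters would contradict each other.\<close>
  have jk: "j = k" using le l Cons.prems(2,3) ks by (auto simp: alcove_refl split: if_splits)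
  have "js = ks'"
  proof (rule Cons.IH)
    show "prod_list (map weyl_refl js) = prod_list (map weyl_refl ks')" using j k jk by simp
    show "int (length js) = \<bar>alcove (prod_list (map weyl_refl js))\<bar>"
      using le l by (auto simp flip: j simp: alcove_refl split: if_splits)
  qed (use Cons.prems ks in auto)
  then show ?case using jk ks by simp
qed auto

text \<open>This makes the definite description in \<open>weyl_reduced\<close> denote: parity fixes
  the exponent of u, and cancelling that power leaves two minimal words for one element of
  W_S.\<close>

lemma weyl_expr_minimal_unique:
  assumes "weyl_expr w i js" "length js = weyl_length w"
    and "weyl_expr w k ks" "length ks = weyl_length w"
  shows "i = k \<and> js = ks"
proof
  show ik: "i = k" using weyl_expr_parity assms by metis
  have x: "prod_list (map weyl_refl js) = weyl_u ^ i * w"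
    "prod_list (map weyl_refl ks) = weyl_u ^ i * w"
    using assms(1,3) ik by (metis weyl_expr_def weyl_u_power_cancel)+
  show "js = ks"
  proof (rule minimal_word_unique)
    show "int (length js) = \<bar>alcove (prod_list (map weyl_refl js))\<bar>"
      using weyl_length_eq[of w] assms(2) by (simp only: x alcove_u_power)
  qed (use assms x in \<open>simp_all add: weyl_expr_def\<close>)
qed

lemma weyl_reduced_eqI:
  assumes "weyl_expr w i js" "length js = weyl_length w"
  shows "weyl_reduced w = (i, js)"
  unfolding weyl_reduced_def
proof (rule the_equality)
  fix p assume "weyl_expr w (fst p) (snd p) \<and> length (snd p) = weyl_length w"
  then have "fst p = i \<and> snd p = js" using weyl_expr_minimal_unique assms by blast
  then show "p = (i, js)" by (simp add: prod_eq_iff)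
qed (simp add: assms)

lemma weyl_reduced_expr:
  "weyl_expr w (fst (weyl_reduced w)) (snd (weyl_reduced w))"
  "length (snd (weyl_reduced w)) = weyl_length w"
proof -
  obtain i js where "weyl_expr w i js" "length js = weyl_length w"
    using weyl_expr_minimal_exists[of w] weyl_length_eq[of w] by auto
  then show "weyl_expr w (fst (weyl_reduced w)) (snd (weyl_reduced w))"
    "length (snd (weyl_reduced w)) = weyl_length w"
    using weyl_reduced_eqI by auto
qed

section \<open>Inverses and their reduced expressions\<close>

lemma weyl_inv_mult: "weyl_inv (v * w) = weyl_inv w * weyl_inv v"
  by transfer (simp add: weyl_eq.refl)

lemma weyl_inv_inv [simp]: "weyl_inv (weyl_inv w) = w"
  by transfer (simp add: weyl_eq.refl)

lemma weyl_inv_one [simp]: "weyl_inv 1 = 1"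
  by transfer (simp add: weyl_eq.refl)

lemma weyl_inv_gens [simp]: "weyl_inv weyl_s = weyl_s" "weyl_inv weyl_u = weyl_u"
  by (transfer; simp add: weyl_eq.refl)+

lemma weyl_inv_refl [simp]: "weyl_inv (weyl_refl j) = weyl_refl j"
  by (simp add: weyl_refl_def weyl_inv_mult mult.assoc)

lemma weyl_inv_prod_refl:
  "weyl_inv (prod_list (map weyl_refl js)) = prod_list (map weyl_refl (rev js))"
  by (induction js) (auto simp: weyl_inv_mult)

lemma weyl_u_refl: "j \<le> 1 \<Longrightarrow> weyl_u * weyl_refl j = weyl_refl (1 - j) * weyl_u"
  by (auto simp: weyl_refl_def mult.assoc weyl_u_u)

text \<open>Here \<open>map ((-) 1)\<close> exchanges the letters 0 and 1, which is the effect of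
  carrying u past the word.\<close>

lemma weyl_u_prod_refl:
  "set js \<subseteq> {0, 1} \<Longrightarrow>
    prod_list (map weyl_refl js) * weyl_u = weyl_u * prod_list (map weyl_refl (map ((-) 1) js))"
proof (induction js)
  case (Cons j js)
  have "weyl_refl j * weyl_u = weyl_u * weyl_refl (1 - j)"
    using Cons.prems weyl_u_refl[of "1 - j"] by auto
  then show ?case using Cons by (simp add: mult.assoc) (metis mult.assoc)
qed simp

text \<open>If w = u x, the inverse is x^-1 u = u (u x^-1 u): the reversed word, with its letters
  exchanged once u is back in front.\<close>

lemma weyl_expr_inv:
  assumes "weyl_expr w i js"
  shows "weyl_expr (weyl_inv w) i (if i = 0 then rev js else map ((-) 1) (rev js))"
proof (cases "i = 0")
  case True
  then show ?thesis using assms by (auto simp: weyl_expr_def weyl_inv_prod_refl)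
next
  case False
  then show ?thesis using assms weyl_u_prod_refl[of "rev js"]
    by (auto simp: weyl_expr_def weyl_inv_prod_refl weyl_inv_mult)
qed

text \<open>Inversion preserves the length of expressions, and as it is an involution one inequality
  gives the other.\<close>

lemma weyl_length_inv [simp]: "weyl_length (weyl_inv w) = weyl_length w"
proof -
  have "weyl_length (weyl_inv w) \<le> weyl_length w" for w
    using weyl_expr_alcove_le[OF weyl_expr_inv[OF weyl_reduced_expr(1)[of w]]] weyl_reduced_expr(2)[of w]
      weyl_length_eq[of "weyl_inv w"] by (auto split: if_splits)
  from this[of w] this[of "weyl_inv w"] show ?thesis by simp
qed

lemma weyl_reduced_inv:
  assumes "weyl_reduced w = (i, js)"
  shows "weyl_reduced (weyl_inv w) = (i, if i = 0 then rev js else map ((-) 1) (rev js))"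
  by (rule weyl_reduced_eqI) (use weyl_reduced_expr[of w] weyl_expr_inv[of w i js] assms in auto)

section \<open>The simply transitive action of W_S on the alcoves\<close>

lemma weyl_S_inv: "w \<in> weyl_S \<Longrightarrow> weyl_inv w \<in> weyl_S"
  unfolding weyl_S_def
proof clarify
  fix js :: "nat list" assume "set js \<subseteq> {0, 1}"
  then show "\<exists>ks. weyl_inv (prod_list (map weyl_refl js)) = prod_list (map weyl_refl ks) \<and>
      set ks \<subseteq> {0, 1}"
    by (intro exI[of _ "rev js"]) (simp add: weyl_inv_prod_refl)
qed

lemma weyl_S_mult: "v \<in> weyl_S \<Longrightarrow> w \<in> weyl_S \<Longrightarrow> v * w \<in> weyl_S"
  unfolding weyl_S_def
proof clarify
  fix js ks :: "nat list" assume "set js \<subseteq> {0, 1}" "set ks \<subseteq> {0, 1}"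
  then show "\<exists>ls. prod_list (map weyl_refl js) * prod_list (map weyl_refl ks) =
      prod_list (map weyl_refl ls) \<and> set ls \<subseteq> {0, 1}"
    by (intro exI[of _ "js @ ks"]) auto
qed

lemma weyl_S_refl: "j \<le> 1 \<Longrightarrow> weyl_refl j \<in> weyl_S"
  unfolding weyl_S_def by (intro CollectI exI[of _ "[j]"]) auto

lemma weyl_S_one: "1 \<in> weyl_S"
  unfolding weyl_S_def by (intro CollectI exI[of _ "[]"]) auto

lemma weyl_S_even: "w \<in> weyl_S \<Longrightarrow> even (weyl_act 1 w n) \<longleftrightarrow> even n"
  unfolding weyl_S_def using even_weyl_refl by auto

text \<open>Elements of W_S preserve parity, so the alcove determines which of its ends is the image
  of 0 and which that of 1. An element fixing both points has length 0 and no factor u.\<close>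

lemma alcove_inj:
  assumes "v \<in> weyl_S" "w \<in> weyl_S" "alcove v = alcove w"
  shows "v = w"
proof -
  have "weyl_act 1 v 0 = weyl_act 1 w 0"
    using weyl_S_even[OF assms(1), of 0] weyl_S_even[OF assms(2), of 0] alcove_ends[of v] alcove_ends[of w]
      assms(3) by (auto simp: alcove_def min_def split: if_splits) presburger+
  moreover have "weyl_act 1 v 1 = weyl_act 1 w 1"
    using calculation alcove_ends[of v] alcove_ends[of w]
      assms(3) by (auto simp: alcove_def min_def split: if_splits)
  ultimately have act: "weyl_act 1 v n = weyl_act 1 w n" for n
    using weyl_act_affine[of 1] by metis
  define x where "x = weyl_inv v * w"
  have id: "weyl_act 1 x n = n" for n
    by (metis act weyl_act_mult weyl_act_one weyl_inv_left x_def)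
  then have "alcove x = 0" by (simp add: alcove_def)
  then have "snd (weyl_reduced x) = []" using weyl_reduced_expr(2)[of x] weyl_length_eq[of x] by simp
  moreover have "fst (weyl_reduced x) = 0"
    using weyl_expr_parity[OF weyl_reduced_expr(1)[of x]] by (simp add: id)
  ultimately have "x = 1" using weyl_reduced_expr(1)[of x] by (simp add: weyl_expr_def)
  then show ?thesis by (metis mult.assoc mult_1 mult_1_right weyl_inv_right x_def)
qed

lemma alcove_surj: "\<exists>w \<in> weyl_S. alcove w = a"
proof (induction "nat \<bar>a\<bar>" arbitrary: a)
  case 0
  then show ?case by (intro bexI[OF _ weyl_S_one]) simp
next
  case (Suc k)
  \<comment> \<open>The reflection at the end of the fundamental alcove on the side of a brings a
    one step nearer; a is nonzero here.\<close>
  define b where "b = (if a > 0 then 1 - a else - a - 1)"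
  obtain w where w: "w \<in> weyl_S" "alcove w = b"
  proof -
    have "k = nat \<bar>b\<bar>" using Suc(2) by (auto simp: b_def)
    then show ?thesis using Suc(1)[of b] that by blast
  qed
  have "weyl_refl (if a > 0 then 0 else 1) * w \<in> weyl_S"
    using w weyl_S_mult weyl_S_refl by simp
  moreover have "alcove (weyl_refl (if a > 0 then 0 else 1) * w) = a"
    using w by (auto simp: alcove_refl b_def)
  ultimately show ?case by blast
qed

section \<open>Shortest elements and nearest alcoves\<close>

lemma weyl_act_inv_iff: "weyl_act M w n = m \<longleftrightarrow> n = weyl_act M (weyl_inv w) m"
  by (metis weyl_act_mult weyl_act_one weyl_inv_left weyl_inv_right)

text \<open>The condition places n in the image of [0, M] under the inverse of w, which by
  \<open>weyl_act_affine\<close> is the alcove of that inverse stretched by M.\<close>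

lemma weyl_act_alcove:
  assumes "M > 0"
  shows "weyl_act M w n \<in> {0..M} \<longleftrightarrow> n \<in> {M * alcove (weyl_inv w)..M * alcove (weyl_inv w) + M}"
proof -
  define v where "v = weyl_inv w"
  define m where "m = weyl_act M w n"
  have n: "n = weyl_act M v m" using m_def v_def weyl_act_inv_iff by metis
  define c where "c = weyl_act 1 v 0"
  consider "weyl_act 1 v 1 = c + 1" | "weyl_act 1 v 1 = c - 1"
    using alcove_ends[of v] c_def by linarith
  then have "m \<in> {0..M} \<longleftrightarrow> n \<in> {M * alcove v..M * alcove v + M}"
  proof cases
    case 1
    then show ?thesis using n weyl_act_affine[of M v m] c_def by (auto simp: alcove_def)
  next
    case 2
    then show ?thesis using n weyl_act_affine[of M v m] c_def
      by (auto simp: alcove_def right_diff_distrib)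
  qed
  then show ?thesis by (simp add: m_def v_def)
qed

text \<open>
  The \<open>a\<close> of least absolute value such that \<open>n\<close> lies in \<open>[aM, aM + M]\<close>. The interval is unique even
  when \<open>n\<close> is a common end of two of them, as their indices then have different absolute values.
\<close>

definition nearest_alcove :: "int \<Rightarrow> int \<Rightarrow> int" where
  "nearest_alcove M n = (if n > 0 then (n - 1) div M else if n = 0 then 0 else n div M)"

lemma nearest_alcove_contains:
  assumes "M > 0"
  shows "n \<in> {M * nearest_alcove M n..M * nearest_alcove M n + M}"
proof -
  have "M * (n div M) \<le> n \<and> n < M * (n div M) + M" for n
    using pos_mod_bound[OF assms, of n] pos_mod_sign[OF assms, of n] mult_div_mod_eq[of M n] by linarith
  from this[of n] this[of "n - 1"] show ?thesis using assms by (auto simp: nearest_alcove_def)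
qed

text \<open>For n > 0 every admissible index is at least \<open>(n - 1) div M\<close>, which is
  nonnegative; for n < 0 every one is at most \<open>n div M\<close>, which is negative. So a tie in
  absolute value cannot involve opposite signs.\<close>

lemma nearest_alcove_minimal:
  assumes "M > 0" "n \<in> {M * a..M * a + M}"
  shows "\<bar>nearest_alcove M n\<bar> \<le> \<bar>a\<bar>" "\<bar>a\<bar> = \<bar>nearest_alcove M n\<bar> \<Longrightarrow> a = nearest_alcove M n"
proof -
  have *: "a \<le> b" if "M * a < M * b + M" for a b
  proof -
    have "M * a < M * (b + 1)" using that by (simp add: distrib_left)
    then show ?thesis using assms(1) by simp
  qed
  have k: "M * (n div M) \<le> n \<and> n < M * (n div M) + M" for n
    using pos_mod_bound[OF assms(1), of n] pos_mod_sign[OF assms(1), of n] mult_div_mod_eq[of M n] by linarith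
  consider "n > 0" | "n = 0" | "n < 0" by linarith
  then have "\<bar>nearest_alcove M n\<bar> \<le> \<bar>a\<bar> \<and> (\<bar>a\<bar> = \<bar>nearest_alcove M n\<bar> \<longrightarrow> a = nearest_alcove M n)"
  proof cases
    case 1
    have "0 \<le> (n - 1) div M" using 1 assms by (simp add: pos_imp_zdiv_nonneg_iff)
    \<comment> \<open>Passing to n - 1 makes the inequality strict, so a positive multiple of M is
      assigned to the interval that ends there.\<close>
    moreover have "(n - 1) div M \<le> a" using *[of "(n - 1) div M" a] k[of "n - 1"] assms(2) by auto
    ultimately show ?thesis using 1 by (auto simp: nearest_alcove_def)
  next
    case 2
    then show ?thesis by (auto simp: nearest_alcove_def)
  next
    case 3
    have "n div M < 0" using 3 assms by (simp add: pos_imp_zdiv_neg_iff)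
    moreover have "a \<le> n div M" using *[of a "n div M"] k[of "n"] assms(2) by auto
    ultimately show ?thesis using 3 by (auto simp: nearest_alcove_def)
  qed
  then show "\<bar>nearest_alcove M n\<bar> \<le> \<bar>a\<bar>" "\<bar>a\<bar> = \<bar>nearest_alcove M n\<bar> \<Longrightarrow> a = nearest_alcove M n" by auto
qed

text \<open>An element takes n into [0, M] exactly when the stretched alcove of its inverse contains
  n, and its length is the distance of that alcove. In W_S the minimum thus belongs to the one
  element whose inverse has the nearest alcove.\<close>

lemma weyl_length_shortest:
  assumes "M > 0"
  shows "int (weyl_length (weyl_shortest M n)) = \<bar>nearest_alcove M n\<bar>"
proof -
  obtain v where v: "v \<in> weyl_S" "alcove v = nearest_alcove M n" using alcove_surj by blast
  have len: "int (weyl_length w) = \<bar>alcove (weyl_inv w)\<bar>" for w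
    using weyl_length_eq[of "weyl_inv w"] by simp
  define w where "w = weyl_inv v"
  have w: "w \<in> weyl_S" "weyl_act M w n \<in> {0..M}" "int (weyl_length w) = \<bar>nearest_alcove M n\<bar>"
    "alcove (weyl_inv w) = nearest_alcove M n"
    using v weyl_S_inv nearest_alcove_contains[OF assms, of n] weyl_act_alcove[OF assms, of w n]
      len[of w] by (simp_all add: w_def)
  have ge: "weyl_length w \<le> weyl_length v" if "weyl_act M v n \<in> {0..M}" for v
    using nearest_alcove_minimal(1)[OF assms, of n "alcove (weyl_inv v)"] weyl_act_alcove[OF assms, of v n]
      that w(3) len[of v] by linarith
  have "weyl_shortest M n = w"
    unfolding weyl_shortest_def
  proof (rule the_equality)
    fix v assume *: "v \<in> weyl_S \<and> weyl_act M v n \<in> {0..M} \<and>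
        (\<forall>x \<in> weyl_S. weyl_act M x n \<in> {0..M} \<longrightarrow> weyl_length v \<le> weyl_length x)"
    then have "weyl_length v = weyl_length w" using ge w by (meson le_antisym)
    then have "alcove (weyl_inv v) = nearest_alcove M n"
      using nearest_alcove_minimal(2)[OF assms, of n "alcove (weyl_inv v)"] weyl_act_alcove[OF assms, of v n]
        * len[of v] len[of w] w(3) by auto
    then have "weyl_inv v = weyl_inv w" using alcove_inj * w weyl_S_inv by metis
    then show "v = w" by (metis weyl_inv_inv)
  qed (use w ge in auto)
  then show ?thesis using w by simp
qed

section \<open>Symmetries of the weight\<close>

lemma minus_div_pos:
  fixes M n :: int
  assumes "M > 0"
  shows "(- n) div M = - 1 - (n - 1) div M"
proof (rule int_div_pos_eq)
  \<comment> \<open>In the division of n - 1 with remainder r, negation turns r into M - 1 - r,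
    which is again a remainder.\<close>
  have "n - 1 = M * ((n - 1) div M) + (n - 1) mod M" by simp
  then show "- n = M * (- 1 - (n - 1) div M) + (M - 1 - (n - 1) mod M)"
    by (simp add: algebra_simps)
  show "0 \<le> M - 1 - (n - 1) mod M" "M - 1 - (n - 1) mod M < M"
    using pos_mod_bound[OF assms, of "n - 1"] pos_mod_sign[OF assms, of "n - 1"] by linarith+
qed

text \<open>The nearest index a of a positive n is nonnegative, and the reflection at 0 sends it to
  -1 - a.\<close>

lemma nearest_alcove_neg:
  assumes "M > 0" "n > 0"
  shows "\<bar>nearest_alcove M (- n)\<bar> = \<bar>nearest_alcove M n\<bar> + 1"
proof -
  have "0 \<le> (n - 1) div M" using assms by (simp add: pos_imp_zdiv_nonneg_iff)
  then show ?thesis using assms by (auto simp: nearest_alcove_def minus_div_pos)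
qed

text \<open>This reflection preserves [0, M] and sends the index a to -a. The case n \<le> 0 is
  computed, n \<ge> M is the same case for M - n, and strictly between both indices are 0.\<close>

lemma nearest_alcove_flip:
  assumes "M > 0"
  shows "\<bar>nearest_alcove M (M - n)\<bar> = \<bar>nearest_alcove M n\<bar>"
proof -
  have pos: "\<bar>nearest_alcove M (M - n)\<bar> = \<bar>nearest_alcove M n\<bar>" if "n \<le> 0" for n
  proof (cases "n = 0")
    case True
    then show ?thesis using assms by (simp add: nearest_alcove_def div_pos_pos_trivial)
  next
    case False
    have "(M - n - 1) div M = 1 + (- n - 1) div M"
      using assms div_add_self1[of M "- n - 1"] by (simp add: algebra_simps)
    moreover have "n div M = - 1 - (- n - 1) div M"
      using minus_div_pos[OF assms, of "- n"] by simp
    moreover have "0 \<le> (- n - 1) div M" using assms that False by (simp add: pos_imp_zdiv_nonneg_iff)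
    ultimately show ?thesis using that False assms by (auto simp: nearest_alcove_def)
  qed
  consider "n \<le> 0" | "n \<ge> M" | "0 < n" "n < M" by linarith
  then show ?thesis
  proof cases
    case 3
    then show ?thesis by (simp add: nearest_alcove_def div_pos_pos_trivial)
  qed (use pos[of n] pos[of "M - n"] in auto)
qed

lemma delta_weight_eq:
  assumes "M > 0"
  shows "delta_weight \<tau> M n = \<tau> ^ (2 * nat \<bar>nearest_alcove M n\<bar>)"
  by (simp add: delta_weight_def flip: weyl_length_shortest[OF assms])

lemma delta_weight_neg:
  assumes "M > 0" "n > 0"
  shows "delta_weight \<tau> M (- n) = \<tau>\<^sup>2 * delta_weight \<tau> M n"
  using nearest_alcove_neg[OF assms] assms(1)
  by (simp add: delta_weight_eq nat_add_distrib power_add algebra_simps power2_eq_square)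

lemma delta_weight_flip: "M > 0 \<Longrightarrow> delta_weight \<tau> M (M - n) = delta_weight \<tau> M n"
  by (simp add: delta_weight_eq nearest_alcove_flip)

lemma delta_weight_pos: "0 < \<tau> \<Longrightarrow> 0 < delta_weight \<tau> M n"
  by (simp add: delta_weight_def)

section \<open>The free algebra and its quotient\<close>

lemma poly_mapping_additive_induct [case_names single add]:
  fixes p :: "'a \<Rightarrow>\<^sub>0 'b::comm_monoid_add"
  assumes single: "\<And>k c. P (Poly_Mapping.single k c)"
    and add: "\<And>p q. P p \<Longrightarrow> P q \<Longrightarrow> P (p + q)"
  shows "P p"
proof (induction p rule: Poly_Mapping.update_induct)
  case const
  \<comment> \<open>The zero mapping is a single term with coefficient 0 at an arbitrary
    key.\<close>
  then show ?case using single[of undefined 0] by simp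
next
  case (update f a b)
  have "Poly_Mapping.update a b f = Poly_Mapping.single a b + f"
    using update.hyps
    by (intro poly_mapping_eqI)
      (auto simp: Poly_Mapping.lookup_update lookup_add lookup_single when_def in_keys_iff)
  then show ?case using single add update by simp
qed

fun word_action :: "('l \<Rightarrow> 'v \<Rightarrow> 'v) \<Rightarrow> 'l fword \<Rightarrow> 'v \<Rightarrow> 'v" where
  "word_action A (FWord xs) = foldr A xs"

text \<open>Linear operators indexed by letters make functions into a module over the free algebra.
  The index type is left general so that two copies of the lattice can be used later.\<close>

definition free_action ::
  "('l \<Rightarrow> ('i \<Rightarrow> complex) \<Rightarrow> 'i \<Rightarrow> complex) \<Rightarrow> ('l fword \<Rightarrow>\<^sub>0 complex) \<Rightarrow>
    ('i \<Rightarrow> complex) \<Rightarrow> 'i \<Rightarrow> complex" where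
  "free_action A p v =
     (\<lambda>i. \<Sum>w\<in>Poly_Mapping.keys p. Poly_Mapping.lookup p w * word_action A w v i)"

definition linear_op :: "(('i \<Rightarrow> complex) \<Rightarrow> 'j \<Rightarrow> complex) \<Rightarrow> bool" where
  "linear_op L \<longleftrightarrow> (\<forall>c d f g. L (\<lambda>i. c * f i + d * g i) = (\<lambda>i. c * L f i + d * L g i))"

lemma linear_opD: "linear_op L \<Longrightarrow> L (\<lambda>i. c * f i + d * g i) = (\<lambda>i. c * L f i + d * L g i)"
  by (simp add: linear_op_def)

lemma linear_op_add: "linear_op L \<Longrightarrow> L (\<lambda>i. f i + g i) = (\<lambda>i. L f i + L g i)"
  using linear_opD[of L 1 f 1 g] by simp

lemma linear_op_scale: "linear_op L \<Longrightarrow> L (\<lambda>i. c * f i) = (\<lambda>i. c * L f i)"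
  using linear_opD[of L c f 0 f] by simp

lemma word_action_zero [simp]: "word_action A 0 = id"
  by (simp add: zero_fword_def)

lemma word_action_add: "word_action A (w + z) v = word_action A w (word_action A z v)"
  by (cases w; cases z) simp

lemma linear_op_word_action:
  assumes "\<And>a. linear_op (A a)"
  shows "linear_op (word_action A w)"
proof (cases w)
  case (FWord xs)
  have "linear_op (foldr A xs)"
    by (induction xs) (use assms in \<open>simp_all add: linear_op_def\<close>)
  then show ?thesis by (simp add: FWord)
qed

text \<open>A common finite index set allows elements with different supports to be added
  termwise.\<close>

lemma free_action_superset:
  assumes "finite S" "Poly_Mapping.keys p \<subseteq> S"
  shows "free_action A p v i = (\<Sum>w\<in>S. Poly_Mapping.lookup p w * word_action A w v i)"
  unfolding free_action_def
  by (rule sum.mono_neutral_left) (use assms in \<open>auto simp: in_keys_iff\<close>)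

lemma free_action_add: "free_action A (p + q) v = (\<lambda>i. free_action A p v i + free_action A q v i)"
proof
  fix i
  let ?S = "Poly_Mapping.keys p \<union> Poly_Mapping.keys q"
  have "Poly_Mapping.keys (p + q) \<subseteq> ?S" by (rule Poly_Mapping.keys_add)
  then show "free_action A (p + q) v i = free_action A p v i + free_action A q v i"
    by (simp add: free_action_superset[of ?S] lookup_add sum.distrib distrib_right)
qed

lemma free_action_single: "free_action A (Poly_Mapping.single w c) v = (\<lambda>i. c * word_action A w v i)"
  by (cases "c = 0") (simp_all add: free_action_def)

lemma free_action_one [simp]: "free_action A 1 v = v"
  using free_action_single[of A 0 1 v] by simp

lemma free_action_uminus: "free_action A (- p) v = (\<lambda>i. - free_action A p v i)"
  by (simp add: free_action_def sum_negf)

lemma free_action_diff: "free_action A (p - q) v = (\<lambda>i. free_action A p v i - free_action A q v i)"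
  using free_action_add[of A p "- q" v] by (simp add: free_action_uminus)

lemma linear_op_free_action:
  assumes "\<And>a. linear_op (A a)"
  shows "linear_op (free_action A p)"
  unfolding linear_op_def free_action_def
  by (simp add: linear_opD[OF linear_op_word_action[OF assms]] sum_distrib_left
      flip: sum.distrib) (simp add: algebra_simps)

text \<open>Additivity in both factors reduces this to single words, where concatenation is
  composition and linearity lets the inner coefficient pass through the outer word.\<close>

lemma free_action_mult:
  assumes "\<And>a. linear_op (A a)"
  shows "free_action A (p * q) v = free_action A p (free_action A q v)"
proof (induction p rule: poly_mapping_additive_induct)
  case (single w c)
  show ?case
  proof (induction q rule: poly_mapping_additive_induct)
    case (single z d)
    then show ?case
      by (simp add: mult_single free_action_single word_action_add mult.assoc
          linear_op_scale[OF linear_op_word_action[OF assms]])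
  next
    case (add p q)
    then show ?case
      by (simp add: distrib_left free_action_add linear_op_add[OF linear_op_free_action[OF assms]])
  qed
next
  case (add p q)
  then show ?case by (simp add: distrib_right free_action_add)
qed

section \<open>The quotient ring and induction over the affine Hecke algebra\<close>

lemma ring_of_type_algebra_ring: "ring (ring_of_type_algebra :: 'a::ring_1 ring)"
proof -
  have "\<exists>y. x + y = 0" for x :: 'a
    using add.right_inverse by blast
  then show ?thesis
    unfolding ring_of_type_algebra_def using add.right_inverse
    by unfold_locales (auto simp: algebra_simps Units_def)
qed

lemma ring_of_type_algebra_simps [simp]:
  "carrier ring_of_type_algebra = UNIV"
  "x \<otimes>\<^bsub>ring_of_type_algebra\<^esub> y = x * y"
  "x \<oplus>\<^bsub>ring_of_type_algebra\<^esub> y = x + y"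
  "\<one>\<^bsub>ring_of_type_algebra\<^esub> = 1"
  "\<zero>\<^bsub>ring_of_type_algebra\<^esub> = 0"
  by (simp_all add: ring_of_type_algebra_def)

lemma ring_of_type_algebra_a_inv [simp]: "\<ominus>\<^bsub>ring_of_type_algebra\<^esub> x = - (x :: 'a::ring_1)"
proof -
  interpret ring "ring_of_type_algebra :: 'a ring" by (rule ring_of_type_algebra_ring)
  show ?thesis by (rule minus_equality) simp_all
qed

lemma ring_of_type_algebra_ideal:
  fixes I :: "'a::ring_1 set"
  assumes "0 \<in> I" "\<And>x y. x \<in> I \<Longrightarrow> y \<in> I \<Longrightarrow> x + y \<in> I" "\<And>x. x \<in> I \<Longrightarrow> - x \<in> I"
    and "\<And>x a. x \<in> I \<Longrightarrow> a * x \<in> I" "\<And>x a. x \<in> I \<Longrightarrow> x * a \<in> I"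
  shows "ideal I ring_of_type_algebra"
proof -
  interpret ring "ring_of_type_algebra :: 'a ring" by (rule ring_of_type_algebra_ring)
  show ?thesis
  proof (rule idealI)
    show "subgroup I (add_monoid ring_of_type_algebra)"
    proof (rule add.subgroupI)
      show "I \<noteq> {}" using assms(1) by blast
    qed (use assms in auto)
  qed (use assms in \<open>auto intro: ring_of_type_algebra_ring\<close>)
qed

definition daha_ideal :: "real \<Rightarrow> daha_free set" where
  "daha_ideal \<tau> = Idl\<^bsub>ring_of_type_algebra\<^esub> (daha_relators \<tau>)"

lemma daha_ideal: "ideal (daha_ideal \<tau>) ring_of_type_algebra"
  unfolding daha_ideal_def
  by (rule ring.genideal_ideal[OF ring_of_type_algebra_ring]) simp

lemma daha_relators_in_ideal: "daha_relators \<tau> \<subseteq> daha_ideal \<tau>"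
  unfolding daha_ideal_def
  by (rule ring.genideal_self[OF ring_of_type_algebra_ring]) simp

lemma daha_ideal_minimal:
  assumes "ideal I ring_of_type_algebra" "daha_relators \<tau> \<subseteq> I"
  shows "daha_ideal \<tau> \<subseteq> I"
  unfolding daha_ideal_def
  by (rule ring.genideal_minimal[OF ring_of_type_algebra_ring assms])

lemma daha_ring: "ring (daha \<tau>)"
  unfolding daha_def daha_ideal_def[symmetric]
  by (rule ideal.quotient_is_ring[OF daha_ideal])

lemma daha_class_hom: "daha_class \<tau> \<in> ring_hom ring_of_type_algebra (daha \<tau>)"
proof -
  have "daha_class \<tau> = (+>\<^bsub>ring_of_type_algebra\<^esub>) (daha_ideal \<tau>)"
    by (auto simp: daha_class_def daha_ideal_def)
  then show ?thesis
    unfolding daha_def daha_ideal_def[symmetric]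
    using ideal.rcos_ring_hom[OF daha_ideal] by simp
qed

lemma daha_class_closed [simp]: "daha_class \<tau> p \<in> carrier (daha \<tau>)"
  using ring_hom_closed[OF daha_class_hom, of p] by simp

lemma daha_class_mult: "daha_class \<tau> p \<otimes>\<^bsub>daha \<tau>\<^esub> daha_class \<tau> q = daha_class \<tau> (p * q)"
  using ring_hom_mult[OF daha_class_hom, of p q] by simp

lemma daha_class_add: "daha_class \<tau> p \<oplus>\<^bsub>daha \<tau>\<^esub> daha_class \<tau> q = daha_class \<tau> (p + q)"
  using ring_hom_add[OF daha_class_hom, of p q] by simp

lemma daha_class_one: "\<one>\<^bsub>daha \<tau>\<^esub> = daha_class \<tau> 1"
  using ring_hom_one[OF daha_class_hom] by simp

lemma daha_class_power: "daha_class \<tau> p [^]\<^bsub>daha \<tau>\<^esub> (n :: nat) = daha_class \<tau> (p ^ n)"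
  by (induction n) (simp_all add: monoid.nat_pow_0[OF ring.is_monoid[OF daha_ring]]
      monoid.nat_pow_Suc[OF ring.is_monoid[OF daha_ring]] daha_class_one daha_class_mult power_Suc2
      del: power_Suc)

lemma daha_class_surj: "h \<in> carrier (daha \<tau>) \<Longrightarrow> \<exists>p. h = daha_class \<tau> p"
  by (auto simp: daha_def FactRing_def A_RCOSETS_def' daha_class_def)

lemma daha_class_eq_iff: "daha_class \<tau> p = daha_class \<tau> q \<longleftrightarrow> p - q \<in> daha_ideal \<tau>"
proof -
  interpret ideal "daha_ideal \<tau>" ring_of_type_algebra by (rule daha_ideal)
  show ?thesis
    using quotient_eq_iff_same_a_r_cos[OF daha_ideal, of p q]
    by (simp add: daha_class_def flip: daha_ideal_def)
      (simp add: a_minus_def)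
qed

lemma daha_class_mult_cong:
  "daha_class \<tau> p = daha_class \<tau> p' \<Longrightarrow> daha_class \<tau> q = daha_class \<tau> q' \<Longrightarrow>
    daha_class \<tau> (p * q) = daha_class \<tau> (p' * q')"
  by (metis daha_class_mult)

lemma daha_class_uminus: "\<ominus>\<^bsub>daha \<tau>\<^esub> daha_class \<tau> p = daha_class \<tau> (- p)"
proof -
  interpret ring "daha \<tau>" by (rule daha_ring)
  have "\<zero>\<^bsub>daha \<tau>\<^esub> = daha_class \<tau> 0"
    using ring_hom_zero[OF daha_class_hom ring_of_type_algebra_ring daha_ring] by simp
  then show ?thesis by (intro minus_equality) (simp_all add: daha_class_add)
qed

lemma affine_hecke_subring: "subring (affine_hecke \<tau>) (daha \<tau>)"
  unfolding affine_hecke_def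
  by (rule ring.generate_ring_is_subring[OF daha_ring])
    (auto simp: daha_scalar_def daha_T_def daha_U_def)

lemma affine_hecke_closed:
  "h \<in> affine_hecke \<tau> \<Longrightarrow> k \<in> affine_hecke \<tau> \<Longrightarrow> h \<oplus>\<^bsub>daha \<tau>\<^esub> k \<in> affine_hecke \<tau>"
  "h \<in> affine_hecke \<tau> \<Longrightarrow> k \<in> affine_hecke \<tau> \<Longrightarrow> h \<otimes>\<^bsub>daha \<tau>\<^esub> k \<in> affine_hecke \<tau>"
  "daha_scalar \<tau> c \<in> affine_hecke \<tau>" "daha_T \<tau> \<in> affine_hecke \<tau>" "daha_U \<tau> \<in> affine_hecke \<tau>"
  unfolding affine_hecke_def by (auto intro: generate_ring.intros)

lemma affine_hecke_class: "h \<in> affine_hecke \<tau> \<Longrightarrow> \<exists>p. h = daha_class \<tau> p"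
  using subringE(1)[OF affine_hecke_subring] daha_class_surj by blast

lemma free_scalar_one: "free_scalar 1 = 1"
  by (simp add: free_scalar_def)

text \<open>The unit is the scalar 1 and additive inverses are multiples by the scalar -1, so the
  scalar and product cases absorb both.\<close>

lemma affine_hecke_induct [consumes 1, case_names scalar T U add mult]:
  assumes "h \<in> affine_hecke \<tau>"
    and scalar: "\<And>c. P (daha_scalar \<tau> c)" and "P (daha_T \<tau>)" "P (daha_U \<tau>)"
    and "\<And>h k. h \<in> affine_hecke \<tau> \<Longrightarrow> k \<in> affine_hecke \<tau> \<Longrightarrow> P h \<Longrightarrow> P k \<Longrightarrow> P (h \<oplus>\<^bsub>daha \<tau>\<^esub> k)"
    and mult: "\<And>h k. h \<in> affine_hecke \<tau> \<Longrightarrow> k \<in> affine_hecke \<tau> \<Longrightarrow> P h \<Longrightarrow> P k \<Longrightarrow> P (h \<otimes>\<^bsub>daha \<tau>\<^esub> k)"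
  shows "P h"
proof -
  have "h \<in> generate_ring (daha \<tau>) (range (daha_scalar \<tau>) \<union> {daha_T \<tau>, daha_U \<tau>})"
    using assms(1) by (simp add: affine_hecke_def)
  then show ?thesis
  proof induction
    case one
    then show ?case using scalar[of 1] by (simp add: daha_scalar_def free_scalar_one daha_class_one)
  next
    case (a_inv h)
    then have h: "h \<in> affine_hecke \<tau>" by (simp add: affine_hecke_def)
    then obtain p where p: "h = daha_class \<tau> p" using affine_hecke_class by blast
    have "free_scalar (- 1) * p = - p"
      by (simp add: free_scalar_def single_uminus)
    then have "\<ominus>\<^bsub>daha \<tau>\<^esub> h = daha_scalar \<tau> (- 1) \<otimes>\<^bsub>daha \<tau>\<^esub> h"
      by (simp add: p daha_class_uminus daha_scalar_def daha_class_mult)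
    then show ?case using mult scalar h a_inv affine_hecke_closed(3) by simp
  qed (use assms in \<open>auto simp: affine_hecke_def\<close>)
qed

section \<open>The anti-involution\<close>

text \<open>Scalars sit at the empty word, which commutes with every word.\<close>

lemma central_free_scalar: "free_scalar c * p = p * free_scalar c"
proof (induction p rule: poly_mapping_additive_induct)
  case (single k d)
  then show ?case by (simp add: free_scalar_def mult_single mult.commute)
qed (simp add: algebra_simps)

section \<open>Reversal with conjugation on the free algebra\<close>

fun fword_rev :: "'a fword \<Rightarrow> 'a fword" where
  "fword_rev (FWord xs) = FWord (rev xs)"

lemma fword_rev_rev [simp]: "fword_rev (fword_rev w) = w"
  by (cases w) simp

lemma inj_fword_rev: "inj fword_rev"
  by (metis fword_rev_rev injI)

lemma fword_rev_add: "fword_rev (w + z) = fword_rev z + fword_rev w"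
  by (cases w; cases z) simp

lemma fword_rev_zero [simp]: "fword_rev 0 = 0"
  by (simp add: zero_fword_def)

text \<open>This is the antilinear anti-involution fixing every letter. Reversal is its own inverse,
  so pulling keys back along it also pushes them forward.\<close>

definition free_star :: "('a fword \<Rightarrow>\<^sub>0 complex) \<Rightarrow> 'a fword \<Rightarrow>\<^sub>0 complex" where
  "free_star p = Poly_Mapping.map_key fword_rev (Poly_Mapping.map cnj p)"

lemma lookup_free_star: "Poly_Mapping.lookup (free_star p) w = cnj (Poly_Mapping.lookup p (fword_rev w))"
  by (simp add: free_star_def Poly_Mapping.map_key.rep_eq[OF inj_fword_rev] Poly_Mapping.map.rep_eq when_def)

lemma free_star_single [simp]:
  "free_star (Poly_Mapping.single w c) = Poly_Mapping.single (fword_rev w) (cnj c)"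
  by (rule poly_mapping_eqI) (auto simp: lookup_free_star lookup_single when_def)

lemma free_star_add [simp]: "free_star (p + q) = free_star p + free_star q"
  by (rule poly_mapping_eqI) (simp add: lookup_free_star lookup_add)

lemma free_star_uminus [simp]: "free_star (- p) = - free_star p"
  by (rule poly_mapping_eqI) (simp add: lookup_free_star)

lemma free_star_diff [simp]: "free_star (p - q) = free_star p - free_star q"
  by (rule poly_mapping_eqI) (simp add: lookup_free_star lookup_minus)

lemma free_star_star [simp]: "free_star (free_star p) = p"
  by (rule poly_mapping_eqI) (simp add: lookup_free_star)

lemma free_star_mult [simp]: "free_star (p * q) = free_star q * free_star p"
proof (induction p rule: poly_mapping_additive_induct)
  case (single w c)
  show ?case
    by (induction q rule: poly_mapping_additive_induct)
      (simp_all add: mult_single fword_rev_add mult.commute algebra_simps)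
qed (simp add: algebra_simps)

lemma free_star_zero [simp]: "free_star 0 = 0"
  using free_star_single[of 0 0] by simp

lemma free_star_one [simp]: "free_star 1 = 1"
  using free_star_single[of 0 1] by simp

lemma free_star_letter [simp]: "free_star (free_letter a) = free_letter a"
  by (simp add: free_letter_def)

lemma free_star_scalar [simp]: "free_star (free_scalar c) = free_scalar (cnj c)"
  by (simp add: free_scalar_def)

text \<open>Reversal exchanges the two inverse relators of a generator and keeps the palindromic
  ones. In the quadratic relator it swaps the factors, which commute as scalars are central, and
  conjugation fixes the real coefficients.\<close>

lemma free_star_relators: "p \<in> daha_relators \<tau> \<Longrightarrow> free_star p \<in> daha_relators \<tau>"
proof -
  assume p: "p \<in> daha_relators \<tau>"
  have comm: "(t + free_scalar a) * (t - free_scalar b) = (t - free_scalar b) * (t + free_scalar a)" for t a b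
    using central_free_scalar[of a t] central_free_scalar[of b t] central_free_scalar[of a "free_scalar b"]
    by (simp add: algebra_simps)
  show ?thesis
    using p by (auto simp: daha_relators_def Let_def comm mult.assoc)
qed

text \<open>The preimage of the ideal under the star is again an ideal, with left and right
  multiplication exchanged, and it contains the relators.\<close>

lemma free_star_ideal:
  assumes "p \<in> daha_ideal \<tau>"
  shows "free_star p \<in> daha_ideal \<tau>"
proof -
  interpret ideal "daha_ideal \<tau>" ring_of_type_algebra by (rule daha_ideal)
  have "ideal {p. free_star p \<in> daha_ideal \<tau>} ring_of_type_algebra"
  proof (rule ring_of_type_algebra_ideal)
    show "0 \<in> {p. free_star p \<in> daha_ideal \<tau>}" using additive_subgroup.zero_closed[OF additive_subgroup_axioms] by simp
  next
    fix x y assume "x \<in> {p. free_star p \<in> daha_ideal \<tau>}" "y \<in> {p. free_star p \<in> daha_ideal \<tau>}"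
    then show "x + y \<in> {p. free_star p \<in> daha_ideal \<tau>}"
      using additive_subgroup.a_closed[OF additive_subgroup_axioms, of "free_star x" "free_star y"] by simp
  next
    fix x assume "x \<in> {p. free_star p \<in> daha_ideal \<tau>}"
    then show "- x \<in> {p. free_star p \<in> daha_ideal \<tau>}"
      using additive_subgroup.a_inv_closed[OF additive_subgroup_axioms, of "free_star x"] by simp
  next
    fix x a assume "x \<in> {p. free_star p \<in> daha_ideal \<tau>}"
    then show "a * x \<in> {p. free_star p \<in> daha_ideal \<tau>}" "x * a \<in> {p. free_star p \<in> daha_ideal \<tau>}"
      using I_r_closed[of "free_star x" "free_star a"] I_l_closed[of "free_star x" "free_star a"] by simp_all
  qed
  moreover have "daha_relators \<tau> \<subseteq> {p. free_star p \<in> daha_ideal \<tau>}"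
    using free_star_relators daha_relators_in_ideal by blast
  ultimately show ?thesis using daha_ideal_minimal assms by blast
qed

lemma free_star_class_cong:
  "daha_class \<tau> p = daha_class \<tau> q \<Longrightarrow>
    daha_class \<tau> (free_star p) = daha_class \<tau> (free_star q)"
  using free_star_ideal[of "p - q" \<tau>] by (simp add: daha_class_eq_iff)

definition daha_star :: "real \<Rightarrow> daha_free set \<Rightarrow> daha_free set" where
  "daha_star \<tau> h = daha_class \<tau> (free_star (SOME p. h = daha_class \<tau> p))"

lemma daha_star_class [simp]: "daha_star \<tau> (daha_class \<tau> p) = daha_class \<tau> (free_star p)"
proof -
  have "daha_class \<tau> p = daha_class \<tau> (SOME q. daha_class \<tau> p = daha_class \<tau> q)" by (rule someI) (rule HOL.refl)
  from free_star_class_cong[OF this] show ?thesis by (simp add: daha_star_def)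
qed

section \<open>The star on the basis elements\<close>

abbreviation free_T :: daha_free where "free_T \<equiv> free_letter (Gen GT)"
abbreviation free_U :: daha_free where "free_U \<equiv> free_letter (Gen GU)"

definition free_refl :: "nat \<Rightarrow> daha_free" where
  "free_refl j = (if j = 0 then free_U * free_T * free_U else free_T)"

lemma daha_class_U_U: "daha_class \<tau> (free_U * free_U) = daha_class \<tau> 1"
proof -
  have "free_U * free_U - 1 \<in> daha_relators \<tau>"
    by (simp add: daha_relators_def Let_def)
  then show ?thesis using daha_relators_in_ideal daha_class_eq_iff by blast
qed

lemma hecke_basis_class:
  "hecke_basis \<tau> w = daha_class \<tau>
     (free_U ^ fst (weyl_reduced w) * prod_list (map free_refl (snd (weyl_reduced w))))"
proof -
  have refl: "hecke_refl \<tau> j = daha_class \<tau> (free_refl j)" for j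
    by (simp add: hecke_refl_def free_refl_def daha_T_def daha_U_def daha_class_mult)
  have "foldr (\<lambda>j h. hecke_refl \<tau> j \<otimes>\<^bsub>daha \<tau>\<^esub> h) js \<one>\<^bsub>daha \<tau>\<^esub> =
      daha_class \<tau> (prod_list (map free_refl js))" for js
    by (induction js) (simp_all add: daha_class_one refl daha_class_mult)
  then show ?thesis by (simp add: hecke_basis_def daha_U_def daha_class_power daha_class_mult)
qed

lemma free_star_prod_refl: "free_star (prod_list (map free_refl js)) = prod_list (map free_refl (rev js))"
  by (induction js) (auto simp: free_refl_def mult.assoc)

text \<open>The two words differ, but their classes agree because U U can be cancelled or
  inserted.\<close>

lemma class_refl_U:
  assumes "j \<le> 1"
  shows "daha_class \<tau> (free_refl j * free_U) = daha_class \<tau> (free_U * free_refl (1 - j))"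
proof (cases "j = 0")
  case True
  then show ?thesis
    using daha_class_mult_cong[OF HOL.refl daha_class_U_U, of \<tau> "free_U * free_T"]
    by (simp add: free_refl_def mult.assoc)
next
  case False
  then show ?thesis
    using daha_class_mult_cong[OF daha_class_U_U HOL.refl, of \<tau> "free_T * free_U"] assms
    by (simp add: free_refl_def mult.assoc)
qed

lemma class_prod_refl_U:
  "set js \<subseteq> {0, 1} \<Longrightarrow> daha_class \<tau> (prod_list (map free_refl js) * free_U) =
    daha_class \<tau> (free_U * prod_list (map free_refl (map ((-) 1) js)))"
proof (induction js)
  case (Cons j js)
  have "daha_class \<tau> (prod_list (map free_refl (j # js)) * free_U) =
      daha_class \<tau> (free_refl j * (prod_list (map free_refl js) * free_U))"
    by (simp add: mult.assoc)
  also have "\<dots> = daha_class \<tau> (free_refl j * (free_U * prod_list (map free_refl (map ((-) 1) js))))"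
    by (rule daha_class_mult_cong) (use Cons in auto)
  also have "\<dots> = daha_class \<tau> ((free_refl j * free_U) * prod_list (map free_refl (map ((-) 1) js)))"
    by (simp add: mult.assoc)
  also have "\<dots> = daha_class \<tau> ((free_U * free_refl (1 - j)) *
      prod_list (map free_refl (map ((-) 1) js)))"
    by (rule daha_class_mult_cong) (use Cons class_refl_U in auto)
  finally show ?case by (simp add: mult.assoc)
qed simp

text \<open>The star reverses the reduced word and leaves U at its end. Moving U to the front
  exchanges the letters, which matches the reduced expression of the inverse in
  \<open>weyl_reduced_inv\<close>.\<close>

lemma daha_star_hecke_basis: "daha_star \<tau> (hecke_basis \<tau> w) = hecke_basis \<tau> (weyl_inv w)"
proof -
  obtain i js where r: "weyl_reduced w = (i, js)" by fastforce
  then have e: "i = 0 \<or> i = 1" "set js \<subseteq> {0, 1}"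
    using weyl_reduced_expr(1)[of w] by (auto simp: weyl_expr_def)
  show ?thesis
    using e class_prod_refl_U[of "rev js" \<tau>]
    by (auto simp: hecke_basis_class r weyl_reduced_inv[OF r] free_star_prod_refl)
qed

text \<open>The basis elements at 1, s and u are the unit, T and U, so the condition on the basis
  prescribes any star on the generators.\<close>

lemma hecke_basis_one: "hecke_basis \<tau> 1 = daha_scalar \<tau> 1"
proof -
  have "weyl_reduced 1 = (0, [])"
    by (rule weyl_reduced_eqI) (use weyl_length_eq[of 1] in \<open>auto simp: weyl_expr_def\<close>)
  then show ?thesis by (simp add: hecke_basis_class daha_scalar_def free_scalar_one)
qed

lemma hecke_basis_s: "hecke_basis \<tau> weyl_s = daha_T \<tau>"
proof -
  have "weyl_reduced weyl_s = (0, [1])"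
    by (rule weyl_reduced_eqI)
      (use weyl_length_eq[of weyl_s] alcove_s[of 1] in \<open>auto simp: weyl_expr_def weyl_refl_def\<close>)
  then show ?thesis by (simp add: hecke_basis_class daha_T_def free_refl_def)
qed

lemma hecke_basis_u: "hecke_basis \<tau> weyl_u = daha_U \<tau>"
proof -
  have "weyl_reduced weyl_u = (1, [])"
    by (rule weyl_reduced_eqI)
      (use weyl_length_eq[of weyl_u] alcove_u[of 1] in \<open>auto simp: weyl_expr_def\<close>)
  then show ?thesis by (simp add: hecke_basis_class daha_U_def)
qed

lemma hecke_basis_in: "hecke_basis \<tau> w \<in> affine_hecke \<tau>"
proof -
  have U: "daha_class \<tau> free_U \<in> affine_hecke \<tau>" and T: "daha_class \<tau> free_T \<in> affine_hecke \<tau>"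
    using affine_hecke_closed(4,5) by (simp_all add: daha_T_def daha_U_def)
  have one: "daha_class \<tau> 1 \<in> affine_hecke \<tau>"
    using affine_hecke_closed(3)[of \<tau> 1] by (simp add: daha_scalar_def free_scalar_one)
  note mult = affine_hecke_closed(2)[of "daha_class \<tau> p" \<tau> "daha_class \<tau> q" for p q, unfolded daha_class_mult]
  have "daha_class \<tau> (prod_list (map free_refl js)) \<in> affine_hecke \<tau>" for js
    by (induction js) (auto simp: free_refl_def intro!: one mult U T)
  moreover have "daha_class \<tau> (free_U ^ i) \<in> affine_hecke \<tau>" for i
    by (induction i) (auto intro!: one mult U)
  ultimately show ?thesis by (simp add: hecke_basis_class mult)
qed

lemma daha_star_closed: "h \<in> affine_hecke \<tau> \<Longrightarrow> daha_star \<tau> h \<in> affine_hecke \<tau>"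
proof (induction rule: affine_hecke_induct)
  case (scalar c)
  then show ?case using affine_hecke_closed(3)[of \<tau> "cnj c"] by (simp add: daha_scalar_def)
next
  case (add h k)
  then obtain p q where "h = daha_class \<tau> p" "k = daha_class \<tau> q" using affine_hecke_class by blast
  then show ?case using affine_hecke_closed(1)[OF add.IH] by (simp add: daha_class_add)
next
  case (mult h k)
  then obtain p q where "h = daha_class \<tau> p" "k = daha_class \<tau> q" using affine_hecke_class by blast
  then show ?case using affine_hecke_closed(2)[OF mult.IH(2,1)] by (simp add: daha_class_mult)
qed (use affine_hecke_closed in \<open>simp_all add: daha_T_def daha_U_def\<close>)

section \<open>Existence and uniqueness of the star\<close>

lemma is_hecke_star_daha_star: "is_hecke_star \<tau> (restrict (daha_star \<tau>) (affine_hecke \<tau>))"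
proof -
  have add: "daha_star \<tau> (h \<oplus>\<^bsub>daha \<tau>\<^esub> k) = daha_star \<tau> h \<oplus>\<^bsub>daha \<tau>\<^esub> daha_star \<tau> k"
    and mult: "daha_star \<tau> (h \<otimes>\<^bsub>daha \<tau>\<^esub> k) = daha_star \<tau> k \<otimes>\<^bsub>daha \<tau>\<^esub> daha_star \<tau> h"
    if "h \<in> affine_hecke \<tau>" "k \<in> affine_hecke \<tau>" for h k
  proof -
    obtain p q where "h = daha_class \<tau> p" "k = daha_class \<tau> q" using affine_hecke_class \<open>h \<in> _\<close> \<open>k \<in> _\<close> by blast
    then show "daha_star \<tau> (h \<oplus>\<^bsub>daha \<tau>\<^esub> k) = daha_star \<tau> h \<oplus>\<^bsub>daha \<tau>\<^esub> daha_star \<tau> k"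
      "daha_star \<tau> (h \<otimes>\<^bsub>daha \<tau>\<^esub> k) = daha_star \<tau> k \<otimes>\<^bsub>daha \<tau>\<^esub> daha_star \<tau> h"
      by (simp_all add: daha_class_add daha_class_mult)
  qed
  have inv: "daha_star \<tau> (daha_star \<tau> h) = h"
    and scale: "daha_star \<tau> (daha_scalar \<tau> c \<otimes>\<^bsub>daha \<tau>\<^esub> h) = daha_scalar \<tau> (cnj c) \<otimes>\<^bsub>daha \<tau>\<^esub> daha_star \<tau> h"
    if "h \<in> affine_hecke \<tau>" for h c
  proof -
    obtain p where "h = daha_class \<tau> p" using affine_hecke_class \<open>h \<in> _\<close> by blast
    then show "daha_star \<tau> (daha_star \<tau> h) = h"
      "daha_star \<tau> (daha_scalar \<tau> c \<otimes>\<^bsub>daha \<tau>\<^esub> h) = daha_scalar \<tau> (cnj c) \<otimes>\<^bsub>daha \<tau>\<^esub> daha_star \<tau> h"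
      by (simp_all add: daha_class_mult daha_scalar_def central_free_scalar)
  qed
  show ?thesis
    unfolding is_hecke_star_def
    using add mult inv scale daha_star_closed affine_hecke_closed hecke_basis_in daha_star_hecke_basis
    by simp
qed

lemma is_hecke_star_gens:
  assumes "is_hecke_star \<tau> \<sigma>"
  shows "\<sigma> (daha_T \<tau>) = daha_T \<tau>" "\<sigma> (daha_U \<tau>) = daha_U \<tau>" "\<sigma> (daha_scalar \<tau> c) = daha_scalar \<tau> (cnj c)"
proof -
  have basis: "\<sigma> (hecke_basis \<tau> w) = hecke_basis \<tau> (weyl_inv w)" for w
    using assms by (simp add: is_hecke_star_def)
  show "\<sigma> (daha_T \<tau>) = daha_T \<tau>" using basis[of weyl_s] by (simp add: hecke_basis_s)
  show "\<sigma> (daha_U \<tau>) = daha_U \<tau>" using basis[of weyl_u] by (simp add: hecke_basis_u)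
  have one: "\<sigma> (daha_scalar \<tau> 1) = daha_scalar \<tau> 1" using basis[of 1] by (simp add: hecke_basis_one)
  have s1: "daha_scalar \<tau> d \<otimes>\<^bsub>daha \<tau>\<^esub> daha_scalar \<tau> 1 = daha_scalar \<tau> d" for d
    by (simp add: daha_scalar_def free_scalar_one daha_class_mult)
  \<comment> \<open>The value at a scalar comes from antilinearity applied to the unit.\<close>
  have "\<sigma> (daha_scalar \<tau> c \<otimes>\<^bsub>daha \<tau>\<^esub> daha_scalar \<tau> 1) = daha_scalar \<tau> (cnj c) \<otimes>\<^bsub>daha \<tau>\<^esub> \<sigma> (daha_scalar \<tau> 1)"
    using assms affine_hecke_closed(3)[of \<tau> 1] by (simp add: is_hecke_star_def)
  then show "\<sigma> (daha_scalar \<tau> c) = daha_scalar \<tau> (cnj c)" by (simp add: one s1)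
qed

text \<open>Agreement on the generators passes through sums and products; outside H extensionality
  makes both maps \<open>undefined\<close>.\<close>

lemma is_hecke_star_unique:
  assumes s: "is_hecke_star \<tau> \<sigma>" and s': "is_hecke_star \<tau> \<sigma>'"
  shows "\<sigma> = \<sigma>'"
proof
  fix h
  show "\<sigma> h = \<sigma>' h"
  proof (cases "h \<in> affine_hecke \<tau>")
    case True
    then show ?thesis
      by (induction rule: affine_hecke_induct)
        (use s s' in \<open>simp_all add: is_hecke_star_gens[OF s] is_hecke_star_gens[OF s'] is_hecke_star_def\<close>)
  next
    case False
    then show ?thesis using s s' by (auto simp: is_hecke_star_def PiE_def extensional_def)
  qed
qed

lemma is_hecke_star_hecke_star: "is_hecke_star \<tau> (hecke_star \<tau>)"
  unfolding hecke_star_def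
  by (rule theI[where P = "is_hecke_star \<tau>", OF is_hecke_star_daha_star])
    (rule is_hecke_star_unique[OF _ is_hecke_star_daha_star])

section \<open>The difference-reflection representation\<close>

text \<open>By the quadratic relation, T - (\<tau> - 1/\<tau>) is the inverse of T.\<close>

definition diffrefl_T_inv :: "real \<Rightarrow> lattice_fun \<Rightarrow> lattice_fun" where
  "diffrefl_T_inv \<tau> f n = diffrefl_T \<tau> f n - of_real (\<tau> - inverse \<tau>) * f n"

definition paired :: "lattice_fun \<Rightarrow> lattice_fun \<Rightarrow> bool \<times> int \<Rightarrow> complex" where
  "paired f g = (\<lambda>(b, n). if b then g n else f n)"

lemma paired_simps [simp]: "paired f g (False, n) = f n" "paired f g (True, n) = g n"
  by (simp_all add: paired_def)

text \<open>
  The operators \<open>T = (t, - u t\<^sup>-\<^sup>1 u)\<close>, \<open>U = (u, - u)\<close> and \<open>X = U V\<close> with \<open>V\<close> the swap of the two copies;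
  here \<open>X\<^sup>-\<^sup>1 = - X\<close>. The index \<open>False\<close> belongs to the first copy.
\<close>

fun double_letter :: "real \<Rightarrow> int \<Rightarrow> daha_letter \<Rightarrow> (bool \<times> int \<Rightarrow> complex) \<Rightarrow> bool \<times> int \<Rightarrow> complex" where
  "double_letter \<tau> M (Gen GT) v = paired (diffrefl_T \<tau> (\<lambda>n. v (False, n)))
     (\<lambda>n. - diffrefl_U M (diffrefl_T_inv \<tau> (diffrefl_U M (\<lambda>n. v (True, n)))) n)"
| "double_letter \<tau> M (Gen_Inv GT) v = paired (diffrefl_T_inv \<tau> (\<lambda>n. v (False, n)))
     (\<lambda>n. - diffrefl_U M (diffrefl_T \<tau> (diffrefl_U M (\<lambda>n. v (True, n)))) n)"
| "double_letter \<tau> M (Gen GX) v = paired (diffrefl_U M (\<lambda>n. v (True, n)))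
     (\<lambda>n. - diffrefl_U M (\<lambda>n. v (False, n)) n)"
| "double_letter \<tau> M (Gen_Inv GX) v = paired (\<lambda>n. - diffrefl_U M (\<lambda>n. v (True, n)) n)
     (diffrefl_U M (\<lambda>n. v (False, n)))"
| "double_letter \<tau> M _ v = paired (diffrefl_U M (\<lambda>n. v (False, n)))
     (\<lambda>n. - diffrefl_U M (\<lambda>n. v (True, n)) n)"

lemma linear_op_double_letter: "linear_op (double_letter \<tau> M a)"
  unfolding linear_op_def
  \<comment> \<open>The rule serves only to distinguish the letters; its vector argument is a
    dummy.\<close>
  by (induction \<tau> M a "undefined :: bool \<times> int \<Rightarrow> complex" rule: double_letter.induct)
    (auto simp: fun_eq_iff paired_def diffrefl_T_def diffrefl_T_inv_def diffrefl_U_def algebra_simps)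

lemma free_action_letter: "free_action A (free_letter a) v = A a v"
  by (simp add: free_letter_def free_action_single)

lemma free_action_scalar: "free_action A (free_scalar c) v = (\<lambda>i. c * v i)"
  by (simp add: free_scalar_def free_action_single)

section \<open>The relations on two copies of the lattice functions\<close>

lemma diffrefl_U_U [simp]: "diffrefl_U M (diffrefl_U M f) = f"
  by (simp add: fun_eq_iff diffrefl_U_def)

lemma diffrefl_U_uminus [simp]: "diffrefl_U M (\<lambda>n. - f n) = (\<lambda>n. - diffrefl_U M f n)"
  by (simp add: fun_eq_iff diffrefl_U_def)

lemma diffrefl_T_uminus [simp]:
  "diffrefl_T \<tau> (\<lambda>n. - f n) = (\<lambda>n. - diffrefl_T \<tau> f n)"
  "diffrefl_T_inv \<tau> (\<lambda>n. - f n) = (\<lambda>n. - diffrefl_T_inv \<tau> f n)"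
  by (auto simp: fun_eq_iff diffrefl_T_def diffrefl_T_inv_def algebra_simps)

text \<open>The operator mixes only values at n and -n: it is multiplication by \<tau> at 0 and a 2
  by 2 block elsewhere, so the signs of n can be checked separately.\<close>

lemma diffrefl_T_quadratic:
  assumes "\<tau> \<noteq> 0"
  shows "diffrefl_T \<tau> (diffrefl_T \<tau> f) n = f n + of_real (\<tau> - inverse \<tau>) * diffrefl_T \<tau> f n"
proof -
  have c: "of_real \<tau> * (inverse (of_real \<tau>) * x) = x" "inverse (of_real \<tau>) * (of_real \<tau> * x) = x" for x :: complex
    using assms by simp_all
  show ?thesis
    unfolding diffrefl_T_def
    by (cases n "0 :: int" rule: linorder_cases) (simp_all add: c distrib_left left_diff_distrib right_diff_distrib)
qed

lemma diffrefl_T_linear: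
  "diffrefl_T \<tau> (\<lambda>n. c * f n + d * g n) = (\<lambda>n. c * diffrefl_T \<tau> f n + d * diffrefl_T \<tau> g n)"
  by (auto simp: fun_eq_iff diffrefl_T_def algebra_simps)

lemma diffrefl_T_inverse [simp]:
  assumes "\<tau> \<noteq> 0"
  shows "diffrefl_T \<tau> (diffrefl_T_inv \<tau> f) = f" "diffrefl_T_inv \<tau> (diffrefl_T \<tau> f) = f"
proof -
  have "diffrefl_T_inv \<tau> f = (\<lambda>n. 1 * diffrefl_T \<tau> f n + (- of_real (\<tau> - inverse \<tau>)) * f n)"
    by (simp add: fun_eq_iff diffrefl_T_inv_def algebra_simps)
  then show "diffrefl_T \<tau> (diffrefl_T_inv \<tau> f) = f"
    using diffrefl_T_quadratic[OF assms] by (simp only: diffrefl_T_linear) (simp add: fun_eq_iff algebra_simps)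
  show "diffrefl_T_inv \<tau> (diffrefl_T \<tau> f) = f"
    using diffrefl_T_quadratic[OF assms] by (simp add: fun_eq_iff diffrefl_T_inv_def)
qed

text \<open>This is the quadratic relation in factored form: T + 1/\<tau> has its range in the
  eigenspace for \<tau>.\<close>

lemma diffrefl_T_factor:
  "diffrefl_T \<tau> (\<lambda>k. diffrefl_T \<tau> f k + inverse (of_real \<tau>) * f k) n =
      of_real \<tau> * (diffrefl_T \<tau> f n + inverse (of_real \<tau>) * f n)"
  unfolding diffrefl_T_def
  by (cases n "0 :: int" rule: linorder_cases) (simp_all add: algebra_simps)

text \<open>It serves the second copy, where T acts as -u t^-1 u: negating t^-1 turns its
  eigenvalues 1/\<tau> and -\<tau> into those of t.\<close>

lemma diffrefl_T_inv_factor: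
  "diffrefl_T_inv \<tau> (\<lambda>k. inverse (of_real \<tau>) * f k - diffrefl_T_inv \<tau> f k) n =
      of_real \<tau> * (diffrefl_T_inv \<tau> f n - inverse (of_real \<tau>) * f n)"
  unfolding diffrefl_T_inv_def diffrefl_T_def
  by (cases n "0 :: int" rule: linorder_cases) (simp_all add: algebra_simps)

lemma free_action_quadratic:
  "free_action (double_letter \<tau> M)
    ((free_letter (Gen GT) - free_scalar (of_real \<tau>)) *
      (free_letter (Gen GT) + free_scalar (inverse (of_real \<tau>)))) v = (\<lambda>_. 0)"
proof
  fix i :: "bool \<times> int"
  obtain b n where i: "i = (b, n)" by fastforce
  have U: "diffrefl_U M = (\<lambda>f n. f (M - n))"
    by (simp add: fun_eq_iff diffrefl_U_def)
  show "free_action (double_letter \<tau> M)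
    ((free_letter (Gen GT) - free_scalar (of_real \<tau>)) *
      (free_letter (Gen GT) + free_scalar (inverse (of_real \<tau>)))) v i = 0"
    by (cases b) (simp_all add: i U free_action_mult[OF linear_op_double_letter] free_action_letter
        free_action_scalar free_action_diff free_action_add diffrefl_T_factor diffrefl_T_inv_factor
        right_diff_distrib)
qed

text \<open>Since X interchanges the copies, in T^-1 X T^-1 each t meets a t^-1 through u and
  cancels; the sign left over gives -X, the inverse of X. In U X U the opposite signs of U on the
  copies do the same.\<close>

lemma free_action_relator:
  assumes "\<tau> \<noteq> 0" "p \<in> daha_relators \<tau>"
  shows "free_action (double_letter \<tau> M) p v = (\<lambda>_. 0)"
proof -
  note mult = free_action_mult[OF linear_op_double_letter]
  have paired_eta: "paired (\<lambda>n. v (False, n)) (\<lambda>n. v (True, n)) = v"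
    by (auto simp: paired_def fun_eq_iff)
  have gen: "double_letter \<tau> M (Gen g) (double_letter \<tau> M (Gen_Inv g) v) = v \<and>
     double_letter \<tau> M (Gen_Inv g) (double_letter \<tau> M (Gen g) v) = v" for g
    using assms(1) by (cases g) (simp_all add: paired_eta)
  show ?thesis
    using assms free_action_quadratic
    by (auto simp: daha_relators_def Let_def free_action_diff mult free_action_letter gen paired_eta)
qed


lemma free_action_ideal:
  assumes "\<tau> \<noteq> 0" "p \<in> daha_ideal \<tau>"
  shows "free_action (double_letter \<tau> M) p v = (\<lambda>_. 0)"
proof -
  \<comment> \<open>Quantifying over all vectors makes the annihilator closed under multiplication
    on the right as well.\<close>
  define K where "K = {p. \<forall>v. free_action (double_letter \<tau> M) p v = (\<lambda>_. 0)}"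
  note mult = free_action_mult[OF linear_op_double_letter]
  have zero: "free_action (double_letter \<tau> M) q (\<lambda>_. 0) = (\<lambda>_. 0)" for q
    using linear_op_scale[OF linear_op_free_action[of "double_letter \<tau> M", OF linear_op_double_letter], where c = 0] by simp
  have "ideal K ring_of_type_algebra"
    by (rule ring_of_type_algebra_ideal)
      (auto simp: K_def free_action_add free_action_uminus mult zero free_action_def[of _ 0])
  moreover have "daha_relators \<tau> \<subseteq> K"
    using free_action_relator[OF assms(1)] by (auto simp: K_def)
  ultimately have "p \<in> K" using daha_ideal_minimal assms(2) by blast
  then show ?thesis by (simp add: K_def)
qed

lemma free_action_class_cong:
  assumes "\<tau> \<noteq> 0" "daha_class \<tau> p = daha_class \<tau> q"
  shows "free_action (double_letter \<tau> M) p v = free_action (double_letter \<tau> M) q v"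
  using free_action_ideal[OF assms(1), of "p - q" M v] assms(2)
  by (simp add: daha_class_eq_iff free_action_diff fun_eq_iff)

section \<open>Compression of the action to the first copy\<close>

definition doubled_rep :: "real \<Rightarrow> int \<Rightarrow> daha_free set \<Rightarrow> lattice_fun \<Rightarrow> lattice_fun" where
  "doubled_rep \<tau> M h f n = free_action (double_letter \<tau> M) (SOME p. h = daha_class \<tau> p)
     (paired f (\<lambda>_. 0)) (False, n)"

text \<open>The ideal acts by zero, so every representative gives the value of the chosen
  one.\<close>

lemma doubled_rep_class:
  assumes "\<tau> \<noteq> 0"
  shows "doubled_rep \<tau> M (daha_class \<tau> p) f = (\<lambda>n. free_action (double_letter \<tau> M) p (paired f (\<lambda>_. 0)) (False, n))"
proof -
  have "daha_class \<tau> p = daha_class \<tau> (SOME q. daha_class \<tau> p = daha_class \<tau> q)"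
    by (rule someI) (rule HOL.refl)
  from free_action_class_cong[OF assms this] show ?thesis
    by (simp add: doubled_rep_def fun_eq_iff)
qed

lemma paired_eq_iff: "v = paired f g \<longleftrightarrow> (\<forall>n. v (False, n) = f n) \<and> (\<forall>n. v (True, n) = g n)"
  by (auto simp: paired_def fun_eq_iff)

text \<open>Compression is multiplicative when the right factor maps the first copy into itself. X
  moves the first copy to the second, so this has to be secured for H separately.\<close>

definition first_block :: "real \<Rightarrow> int \<Rightarrow> daha_free \<Rightarrow> bool" where
  "first_block \<tau> M p \<longleftrightarrow> (\<forall>f n. free_action (double_letter \<tau> M) p (paired f (\<lambda>_. 0)) (True, n) = 0)"

lemma first_block_class_cong:
  assumes "\<tau> \<noteq> 0" "daha_class \<tau> p = daha_class \<tau> q"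
  shows "first_block \<tau> M p \<longleftrightarrow> first_block \<tau> M q"
  by (simp add: first_block_def free_action_class_cong[OF assms])

lemma first_block_action:
  assumes "\<tau> \<noteq> 0" "first_block \<tau> M p"
  shows "free_action (double_letter \<tau> M) p (paired f (\<lambda>_. 0)) =
    paired (doubled_rep \<tau> M (daha_class \<tau> p) f) (\<lambda>_. 0)"
  using assms by (simp add: paired_eq_iff first_block_def doubled_rep_class)

lemma first_block_add: "first_block \<tau> M p \<Longrightarrow> first_block \<tau> M q \<Longrightarrow> first_block \<tau> M (p + q)"
  by (simp add: first_block_def free_action_add)

lemma first_block_mult:
  assumes "\<tau> \<noteq> 0" "first_block \<tau> M p" "first_block \<tau> M q"
  shows "first_block \<tau> M (p * q)"
  unfolding first_block_def free_action_mult[OF linear_op_double_letter] first_block_action[OF assms(1,3)]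
  using assms(2) by (simp add: first_block_def)

text \<open>Scalars, T and U act block diagonally, and the property depends only on the class; hence
  p is arbitrary in the induction and a convenient representative can be used in each case.\<close>

lemma first_block_affine_hecke:
  assumes "\<tau> \<noteq> 0" "h \<in> affine_hecke \<tau>"
  shows "h = daha_class \<tau> p \<Longrightarrow> first_block \<tau> M p"
  using assms(2)
proof (induction arbitrary: p rule: affine_hecke_induct)
  case (scalar c)
  have "first_block \<tau> M (free_scalar c)"
    by (simp add: first_block_def free_action_scalar)
  then show ?case using first_block_class_cong[OF assms(1)] scalar unfolding daha_scalar_def by blast
next
  case T
  have "first_block \<tau> M (free_letter (Gen GT))"
    by (simp add: first_block_def free_action_letter diffrefl_U_def diffrefl_T_inv_def diffrefl_T_def)
  then show ?case using first_block_class_cong[OF assms(1)] T unfolding daha_T_def by blast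
next
  case U
  have "first_block \<tau> M (free_letter (Gen GU))"
    by (simp add: first_block_def free_action_letter diffrefl_U_def)
  then show ?case using first_block_class_cong[OF assms(1)] U unfolding daha_U_def by blast
next
  case (add h k)
  obtain a b where h: "h = daha_class \<tau> a" "k = daha_class \<tau> b" using add.hyps affine_hecke_class by blast
  have "first_block \<tau> M (a + b)" using first_block_add add.IH h by blast
  moreover have "daha_class \<tau> (a + b) = daha_class \<tau> p" using add.prems h by (simp add: daha_class_add)
  ultimately show ?case using first_block_class_cong[OF assms(1)] by blast
next
  case (mult h k)
  obtain a b where h: "h = daha_class \<tau> a" "k = daha_class \<tau> b" using mult.hyps affine_hecke_class by blast
  have "first_block \<tau> M (a * b)" using first_block_mult[OF assms(1)] mult.IH h by blast
  moreover have "daha_class \<tau> (a * b) = daha_class \<tau> p" using mult.prems h by (simp add: daha_class_mult)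
  ultimately show ?case using first_block_class_cong[OF assms(1)] by blast
qed

lemma is_diffrefl_rep_exists:
  assumes "\<tau> \<noteq> 0"
  shows "is_diffrefl_rep \<tau> M (restrict (doubled_rep \<tau> M) (affine_hecke \<tau>))"
proof -
  have add: "doubled_rep \<tau> M (h \<oplus>\<^bsub>daha \<tau>\<^esub> k) f = (\<lambda>n. doubled_rep \<tau> M h f n + doubled_rep \<tau> M k f n)"
    and mult: "doubled_rep \<tau> M (h \<otimes>\<^bsub>daha \<tau>\<^esub> k) f = doubled_rep \<tau> M h (doubled_rep \<tau> M k f)"
    if "h \<in> affine_hecke \<tau>" "k \<in> affine_hecke \<tau>" for h k f
  proof -
    note hk = that
    obtain a where a: "h = daha_class \<tau> a" using affine_hecke_class[OF hk(1)] by blast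
    obtain b where b: "k = daha_class \<tau> b" using affine_hecke_class[OF hk(2)] by blast
    show "doubled_rep \<tau> M (h \<oplus>\<^bsub>daha \<tau>\<^esub> k) f = (\<lambda>n. doubled_rep \<tau> M h f n + doubled_rep \<tau> M k f n)"
      by (simp add: a b daha_class_add doubled_rep_class[OF assms] free_action_add)
    show "doubled_rep \<tau> M (h \<otimes>\<^bsub>daha \<tau>\<^esub> k) f = doubled_rep \<tau> M h (doubled_rep \<tau> M k f)"
      \<comment> \<open>The right factor keeps the second component zero, so its result is again of
        the form on which the compressed left factor is evaluated.\<close>
      using first_block_action[OF assms first_block_affine_hecke[OF assms hk(2) b], of M f]
      by (simp add: a b daha_class_mult doubled_rep_class[OF assms] free_action_mult[OF linear_op_double_letter])
  qed
  have linear: "doubled_rep \<tau> M h (\<lambda>n. c * f n + d * g n) = (\<lambda>n. c * doubled_rep \<tau> M h f n + d * doubled_rep \<tau> M h g n)"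
    for h c d f g
  proof -
    have "paired (\<lambda>n. c * f n + d * g n) (\<lambda>_. 0) = (\<lambda>i. c * paired f (\<lambda>_. 0) i + d * paired g (\<lambda>_. 0) i)"
      by (auto simp: fun_eq_iff paired_def)
    then show ?thesis
      by (simp add: doubled_rep_def[abs_def]
          linear_opD[OF linear_op_free_action[of "double_letter \<tau> M", OF linear_op_double_letter]])
  qed
  show ?thesis
    unfolding is_diffrefl_rep_def hecke_rep_on_def
    using affine_hecke_closed add mult linear
    by (simp add: daha_scalar_def daha_T_def daha_U_def doubled_rep_class[OF assms] free_action_scalar
        free_action_letter fun_eq_iff)
qed

lemma is_diffrefl_rep_unique:
  assumes r: "is_diffrefl_rep \<tau> M \<rho>" and r': "is_diffrefl_rep \<tau> M \<rho>'"
  shows "\<rho> = \<rho>'"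
proof
  fix h
  show "\<rho> h = \<rho>' h"
  proof (cases "h \<in> affine_hecke \<tau>")
    case True
    then show ?thesis
      by (induction rule: affine_hecke_induct; intro ext;
          use r r' in \<open>simp add: is_diffrefl_rep_def hecke_rep_on_def\<close>)
  next
    case False
    then show ?thesis using r r' by (auto simp: is_diffrefl_rep_def extensional_def)
  qed
qed

lemma is_diffrefl_rep_diffrefl_rep:
  assumes "\<tau> \<noteq> 0"
  shows "is_diffrefl_rep \<tau> M (diffrefl_rep \<tau> M)"
  unfolding diffrefl_rep_def
  by (rule theI[where P = "is_diffrefl_rep \<tau> M", OF is_diffrefl_rep_exists[OF assms]])
    (rule is_diffrefl_rep_unique[OF _ is_diffrefl_rep_exists[OF assms]])

section \<open>Bounded operators and adjoints\<close>

text \<open>Writing T with multipliers and the reflection allows boundedness and self-adjointness to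
  be proved for each summand.\<close>

lemma diffrefl_T_split:
  "diffrefl_T \<tau> f n = of_real (if n \<ge> 0 then \<tau> else inverse \<tau>) * f (- n) +
    of_real (if n \<ge> 0 then 0 else \<tau> - inverse \<tau>) * f n"
  by (simp add: diffrefl_T_def)

context
  fixes \<tau> :: real and M :: int
  assumes \<tau>_pos: "0 < \<tau>" and \<tau>_less: "\<tau> < 1" and M_gt: "M > 1"
begin

text \<open>The squared norm as a real sum, so that estimates involve neither complex sums nor
  roots.\<close>

definition energy :: "lattice_fun \<Rightarrow> real" where
  "energy f = (\<Sum>\<^sub>\<infinity>n. (cmod (f n))\<^sup>2 * delta_weight \<tau> M n)"

definition bounded_l2 :: "(lattice_fun \<Rightarrow> lattice_fun) \<Rightarrow> bool" where
  "bounded_l2 L \<longleftrightarrow>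
    (\<exists>C\<ge>0. \<forall>f \<in> l2_delta \<tau> M. L f \<in> l2_delta \<tau> M \<and> energy (L f) \<le> C * energy f)"

definition adjoint_l2 :: "(lattice_fun \<Rightarrow> lattice_fun) \<Rightarrow> (lattice_fun \<Rightarrow> lattice_fun) \<Rightarrow> bool" where
  "adjoint_l2 L L' \<longleftrightarrow>
    (\<forall>f \<in> l2_delta \<tau> M. \<forall>g \<in> l2_delta \<tau> M. inner_delta \<tau> M (L f) g = inner_delta \<tau> M f (L' g))"

section \<open>Boundedness of the operators of the generators\<close>

lemma \<delta>_pos: "0 < delta_weight \<tau> M n"
  using \<tau>_pos by (rule delta_weight_pos)

lemma l2_bound:
  assumes G: "G summable_on UNIV" and le: "\<And>n. (cmod (f n))\<^sup>2 * delta_weight \<tau> M n \<le> G n"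
  shows "f \<in> l2_delta \<tau> M" "energy f \<le> infsum G UNIV"
proof -
  have s: "(\<lambda>n. (cmod (f n))\<^sup>2 * delta_weight \<tau> M n) summable_on UNIV"
    by (rule summable_on_comparison_test[OF G])
      (use le \<delta>_pos[THEN less_imp_le] in simp_all)
  then show "f \<in> l2_delta \<tau> M" by (simp add: l2_delta_def)
  show "energy f \<le> infsum G UNIV"
    unfolding energy_def by (rule infsum_mono[OF s G le])
qed

lemma l2D: "f \<in> l2_delta \<tau> M \<Longrightarrow> (\<lambda>n. (cmod (f n))\<^sup>2 * delta_weight \<tau> M n) summable_on UNIV"
  by (simp add: l2_delta_def)

lemma bounded_l2_multiplier:
  assumes "\<And>n. cmod (a n) \<le> B"
  shows "bounded_l2 (\<lambda>f n. a n * f n)"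
  unfolding bounded_l2_def
proof (intro exI conjI ballI)
  show "0 \<le> B\<^sup>2" by simp
  fix f assume f: "f \<in> l2_delta \<tau> M"
  let ?G = "\<lambda>n. B\<^sup>2 * ((cmod (f n))\<^sup>2 * delta_weight \<tau> M n)"
  have G: "?G summable_on UNIV" by (rule summable_on_cmult_right[OF l2D[OF f]])
  have "(cmod (a n * f n))\<^sup>2 * delta_weight \<tau> M n \<le> ?G n" for n
  proof -
    have "(cmod (a n))\<^sup>2 \<le> B\<^sup>2" using assms[of n] by (simp add: power_mono)
    then have "(cmod (a n))\<^sup>2 * ((cmod (f n))\<^sup>2 * delta_weight \<tau> M n) \<le> ?G n"
      by (rule mult_right_mono) (use \<delta>_pos[THEN less_imp_le] in simp)
    then show ?thesis by (simp add: norm_mult power_mult_distrib mult.assoc)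
  qed
  from l2_bound[OF G this] show "(\<lambda>n. a n * f n) \<in> l2_delta \<tau> M"
    "energy (\<lambda>n. a n * f n) \<le> B\<^sup>2 * energy f"
    by (simp_all add: energy_def infsum_cmult_right')
qed

text \<open>After the substitution only the ratio of the weights at n and at \<open>\<phi> n\<close>
  matters, and C bounds it.\<close>

lemma bounded_l2_reindex:
  assumes bij: "bij \<phi>" and C: "0 \<le> C" and le: "\<And>n. delta_weight \<tau> M n \<le> C * delta_weight \<tau> M (\<phi> n)"
  shows "bounded_l2 (\<lambda>f n. f (\<phi> n))"
  unfolding bounded_l2_def
proof (intro exI conjI ballI)
  show "0 \<le> C" by fact
  fix f assume f: "f \<in> l2_delta \<tau> M"
  let ?E = "\<lambda>n. (cmod (f n))\<^sup>2 * delta_weight \<tau> M n"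
  let ?G = "\<lambda>n. C * ?E (\<phi> n)"
  have "(\<lambda>n. ?E (\<phi> n)) summable_on UNIV"
    using l2D[OF f] summable_on_reindex_bij_betw[OF bij, of ?E] by blast
  then have G: "?G summable_on UNIV" by (rule summable_on_cmult_right)
  have sum: "infsum ?G UNIV = C * energy f"
    unfolding infsum_cmult_right' infsum_reindex_bij_betw[OF bij, of ?E] energy_def by (rule HOL.refl)
  have "(cmod (f (\<phi> n)))\<^sup>2 * delta_weight \<tau> M n \<le> ?G n" for n
    using mult_left_mono[OF le[of n], of "(cmod (f (\<phi> n)))\<^sup>2"] by (simp add: algebra_simps)
  from l2_bound[OF G this] show "(\<lambda>n. f (\<phi> n)) \<in> l2_delta \<tau> M"
    "energy (\<lambda>n. f (\<phi> n)) \<le> C * energy f"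
    unfolding sum .
qed

lemma bounded_l2_add:
  assumes "bounded_l2 K" "bounded_l2 L"
  shows "bounded_l2 (\<lambda>f n. K f n + L f n)"
proof -
  obtain C where C: "0 \<le> C" "\<And>f. f \<in> l2_delta \<tau> M \<Longrightarrow> K f \<in> l2_delta \<tau> M \<and> energy (K f) \<le> C * energy f"
    using assms(1) unfolding bounded_l2_def by blast
  obtain D where D: "0 \<le> D" "\<And>f. f \<in> l2_delta \<tau> M \<Longrightarrow> L f \<in> l2_delta \<tau> M \<and> energy (L f) \<le> D * energy f"
    using assms(2) unfolding bounded_l2_def by blast
  show ?thesis
    unfolding bounded_l2_def
  proof (intro exI conjI ballI)
    \<comment> \<open>The factor 2 comes from (x + y)^2 \<le> 2 (x^2 + y^2).\<close>
    show "0 \<le> 2 * (C + D)" using C D by simp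
    fix f assume f: "f \<in> l2_delta \<tau> M"
    let ?G = "\<lambda>n. 2 * ((cmod (K f n))\<^sup>2 * delta_weight \<tau> M n + (cmod (L f n))\<^sup>2 * delta_weight \<tau> M n)"
    have KL: "K f \<in> l2_delta \<tau> M" "L f \<in> l2_delta \<tau> M" using C D f by auto
    have G: "?G summable_on UNIV"
      by (intro summable_on_cmult_right summable_on_add l2D KL)
    have sum: "infsum ?G UNIV = 2 * (energy (K f) + energy (L f))"
      unfolding infsum_cmult_right' infsum_add[OF l2D[OF KL(1)] l2D[OF KL(2)]] energy_def by (rule HOL.refl)
    have "(cmod (K f n + L f n))\<^sup>2 * delta_weight \<tau> M n \<le> ?G n" for n
    proof -
      have "(cmod (K f n + L f n))\<^sup>2 \<le> (cmod (K f n) + cmod (L f n))\<^sup>2"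
        by (simp add: norm_triangle_ineq power_mono)
      also have "\<dots> \<le> 2 * ((cmod (K f n))\<^sup>2 + (cmod (L f n))\<^sup>2)"
        using sum_squares_bound[of "cmod (K f n)" "cmod (L f n)"] by (simp add: power2_sum)
      finally have "(cmod (K f n + L f n))\<^sup>2 * delta_weight \<tau> M n \<le>
          2 * ((cmod (K f n))\<^sup>2 + (cmod (L f n))\<^sup>2) * delta_weight \<tau> M n"
        by (rule mult_right_mono) (use \<delta>_pos[THEN less_imp_le] in simp)
      then show ?thesis by (simp add: algebra_simps)
    qed
    from l2_bound[OF G this, unfolded sum] C(2)[OF f] D(2)[OF f]
    show "(\<lambda>n. K f n + L f n) \<in> l2_delta \<tau> M"
      "energy (\<lambda>n. K f n + L f n) \<le> 2 * (C + D) * energy f"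
      by (auto simp: algebra_simps)
  qed
qed

lemma bounded_l2_comp:
  assumes "bounded_l2 K" "bounded_l2 L"
  shows "bounded_l2 (\<lambda>f. K (L f))"
proof -
  obtain C where C: "0 \<le> C" "\<And>f. f \<in> l2_delta \<tau> M \<Longrightarrow> K f \<in> l2_delta \<tau> M \<and> energy (K f) \<le> C * energy f"
    using assms(1) unfolding bounded_l2_def by blast
  obtain D where D: "0 \<le> D" "\<And>f. f \<in> l2_delta \<tau> M \<Longrightarrow> L f \<in> l2_delta \<tau> M \<and> energy (L f) \<le> D * energy f"
    using assms(2) unfolding bounded_l2_def by blast
  show ?thesis
    unfolding bounded_l2_def
  proof (intro exI conjI ballI)
    show "0 \<le> C * D" using C D by simp
    fix f assume f: "f \<in> l2_delta \<tau> M"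
    have Lf: "L f \<in> l2_delta \<tau> M" "energy (L f) \<le> D * energy f" using D(2)[OF f] by auto
    show "K (L f) \<in> l2_delta \<tau> M" using C(2)[OF Lf(1)] by simp
    have "energy (K (L f)) \<le> C * energy (L f)" using C(2)[OF Lf(1)] by simp
    also have "\<dots> \<le> C * (D * energy f)" by (rule mult_left_mono[OF Lf(2) C(1)])
    finally show "energy (K (L f)) \<le> C * D * energy f" by (simp add: mult.assoc)
  qed
qed

lemma bounded_l2_flip: "bounded_l2 (\<lambda>f n. f (- n))"
proof (rule bounded_l2_reindex)
  show "bij (\<lambda>n. - n :: int)" by (rule bij_uminus)
  \<comment> \<open>The ratio of the weights at n and -n is largest for n > 0, where it equals this
    constant.\<close>
  show "0 \<le> inverse (\<tau>\<^sup>2)" by simp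
  fix n :: int
  have t: "\<tau>\<^sup>2 \<le> 1" "0 < \<tau>\<^sup>2" using \<tau>_pos \<tau>_less by (simp_all add: power_le_one)
  consider "n > 0" | "n = 0" | "n < 0" by linarith
  then have "\<tau>\<^sup>2 * delta_weight \<tau> M n \<le> delta_weight \<tau> M (- n)"
  proof cases
    case 1
    then show ?thesis using delta_weight_neg[of M n \<tau>] M_gt by simp
  next
    case 2
    then show ?thesis using t \<delta>_pos[of 0] by (simp add: mult_left_le_one_le)
  next
    case 3
    then have "delta_weight \<tau> M n = \<tau>\<^sup>2 * delta_weight \<tau> M (- n)"
      using delta_weight_neg[of M "- n" \<tau>] M_gt by simp
    moreover have "\<tau>\<^sup>2 * (\<tau>\<^sup>2 * delta_weight \<tau> M (- n)) \<le> delta_weight \<tau> M (- n)"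
      using t \<delta>_pos[of "- n"] by (intro order.trans[OF mult_left_le_one_le mult_left_le_one_le]) simp_all
    ultimately show ?thesis by simp
  qed
  then show "delta_weight \<tau> M n \<le> inverse (\<tau>\<^sup>2) * delta_weight \<tau> M (- n)"
    using t by (simp add: field_simps)
qed

lemma bounded_l2_T: "bounded_l2 (diffrefl_T \<tau>)"
proof -
  have b: "bounded_l2 (\<lambda>f n. of_real (if n \<ge> 0 then c else d) * f n)" for c d :: real
    by (rule bounded_l2_multiplier[where B = "max \<bar>c\<bar> \<bar>d\<bar>"]) auto
  show ?thesis
    using bounded_l2_add[OF bounded_l2_comp[OF b bounded_l2_flip] b]
    unfolding diffrefl_T_split[abs_def] .
qed

lemma bounded_l2_U: "bounded_l2 (diffrefl_U M)"
proof -
  have "bij (\<lambda>n. M - n)" by (rule bij_betw_byWitness[where f' = "\<lambda>n. M - n"]) auto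
  then have "bounded_l2 (\<lambda>f n. f (M - n))"
    by (rule bounded_l2_reindex[where C = 1]) (use delta_weight_flip[of M \<tau>] M_gt in simp_all)
  then show ?thesis by (simp add: diffrefl_U_def[abs_def])
qed

text \<open>An \<open>infsum\<close> that does not converge is 0 by default, so additivity of the
  inner product rests on this summability. It follows from xy \<le> x^2 + y^2 for the absolute
  values.\<close>

lemma inner_summable:
  assumes f: "f \<in> l2_delta \<tau> M" and g: "g \<in> l2_delta \<tau> M"
  shows "(\<lambda>n. f n * cnj (g n) * of_real (delta_weight \<tau> M n)) summable_on UNIV"
proof (rule abs_summable_summable, rule summable_on_comparison_test)
  show "(\<lambda>n. (cmod (f n))\<^sup>2 * delta_weight \<tau> M n + (cmod (g n))\<^sup>2 * delta_weight \<tau> M n) summable_on UNIV"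
    by (intro summable_on_add l2D f g)
  fix n
  have "cmod (f n) * cmod (g n) \<le> (cmod (f n))\<^sup>2 + (cmod (g n))\<^sup>2"
    using sum_squares_bound[of "cmod (f n)" "cmod (g n)"]
      mult_nonneg_nonneg[OF norm_ge_zero norm_ge_zero, of "f n" "g n"] by linarith
  then have "cmod (f n) * cmod (g n) * delta_weight \<tau> M n \<le> ((cmod (f n))\<^sup>2 + (cmod (g n))\<^sup>2) * delta_weight \<tau> M n"
    by (rule mult_right_mono) (use \<delta>_pos[THEN less_imp_le] in simp)
  then show "norm (f n * cnj (g n) * of_real (delta_weight \<tau> M n)) \<le>
      (cmod (f n))\<^sup>2 * delta_weight \<tau> M n + (cmod (g n))\<^sup>2 * delta_weight \<tau> M n"
    using \<delta>_pos[of n] by (simp add: norm_mult distrib_right)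
qed simp

lemma norm_delta_eq:
  assumes "f \<in> l2_delta \<tau> M"
  shows "norm_delta \<tau> M f = sqrt (energy f)"
proof -
  have "f n * cnj (f n) * of_real (delta_weight \<tau> M n) = of_real ((cmod (f n))\<^sup>2 * delta_weight \<tau> M n)" for n
    by (simp only: of_real_mult complex_norm_square)
  then have "inner_delta \<tau> M f f = (\<Sum>\<^sub>\<infinity>n. of_real ((cmod (f n))\<^sup>2 * delta_weight \<tau> M n))"
    by (simp only: inner_delta_def)
  also have "\<dots> = of_real (energy f)"
    unfolding energy_def
    by (rule infsumI) (use has_sum_infsum[OF l2D[OF assms]] in \<open>simp only: has_sum_of_real_iff\<close>)
  finally show ?thesis by (simp add: norm_delta_def)
qed

lemma bounded_l2_norm:
  assumes "bounded_l2 L"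
  shows "\<exists>C. \<forall>f \<in> l2_delta \<tau> M. norm_delta \<tau> M (L f) \<le> C * norm_delta \<tau> M f"
proof -
  obtain C where C: "0 \<le> C" "\<And>f. f \<in> l2_delta \<tau> M \<Longrightarrow> L f \<in> l2_delta \<tau> M \<and> energy (L f) \<le> C * energy f"
    using assms unfolding bounded_l2_def by blast
  \<comment> \<open>C bounds squared norms, so its root bounds norms.\<close>
  have "norm_delta \<tau> M (L f) \<le> sqrt C * norm_delta \<tau> M f" if f: "f \<in> l2_delta \<tau> M" for f
    using C(2)[OF f] f by (simp add: norm_delta_eq flip: real_sqrt_mult)
  then show ?thesis by blast
qed

section \<open>Adjoints\<close>

lemma bounded_l2_closed: "bounded_l2 L \<Longrightarrow> f \<in> l2_delta \<tau> M \<Longrightarrow> L f \<in> l2_delta \<tau> M"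
  unfolding bounded_l2_def by blast

lemma adjoint_l2_add:
  assumes "adjoint_l2 K K'" "adjoint_l2 L L'"
    and b: "bounded_l2 K" "bounded_l2 L" "bounded_l2 K'" "bounded_l2 L'"
  shows "adjoint_l2 (\<lambda>f n. K f n + L f n) (\<lambda>f n. K' f n + L' f n)"
  unfolding adjoint_l2_def
proof (intro ballI)
  fix f g assume f: "f \<in> l2_delta \<tau> M" and g: "g \<in> l2_delta \<tau> M"
  have "inner_delta \<tau> M (\<lambda>n. K f n + L f n) g = inner_delta \<tau> M (K f) g + inner_delta \<tau> M (L f) g"
    unfolding inner_delta_def distrib_right
    by (rule infsum_add) (intro inner_summable f g bounded_l2_closed[OF b(1)] bounded_l2_closed[OF b(2)]
        bounded_l2_closed[OF b(3)] bounded_l2_closed[OF b(4)])+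
  moreover have "inner_delta \<tau> M f (\<lambda>n. K' g n + L' g n) = inner_delta \<tau> M f (K' g) + inner_delta \<tau> M f (L' g)"
    unfolding inner_delta_def distrib_right distrib_left complex_cnj_add
    by (rule infsum_add) (intro inner_summable f g bounded_l2_closed[OF b(1)] bounded_l2_closed[OF b(2)]
        bounded_l2_closed[OF b(3)] bounded_l2_closed[OF b(4)])+
  ultimately show "inner_delta \<tau> M (\<lambda>n. K f n + L f n) g = inner_delta \<tau> M f (\<lambda>n. K' g n + L' g n)"
    using assms(1,2) f g by (simp add: adjoint_l2_def)
qed

lemma adjoint_l2_comp:
  assumes "adjoint_l2 K K'" "adjoint_l2 L L'" "bounded_l2 L" "bounded_l2 K'"
  shows "adjoint_l2 (\<lambda>f. K (L f)) (\<lambda>f. L' (K' f))"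
  unfolding adjoint_l2_def
proof (intro ballI)
  fix f g assume f: "f \<in> l2_delta \<tau> M" and g: "g \<in> l2_delta \<tau> M"
  have "L f \<in> l2_delta \<tau> M" "K' g \<in> l2_delta \<tau> M"
    using bounded_l2_closed assms(3,4) f g by blast+
  then show "inner_delta \<tau> M (K (L f)) g = inner_delta \<tau> M f (L' (K' g))"
    using assms(1,2) f g unfolding adjoint_l2_def by simp
qed

text \<open>Substituting \<open>\<phi> n\<close> for n, an involution, carries one inner product
  into the other; the balance condition on a compensates for the changed weight.\<close>

lemma adjoint_l2_reindex:
  assumes inv: "\<And>n. \<phi> (\<phi> n) = n"
    and a: "\<And>n. a (\<phi> n) * of_real (delta_weight \<tau> M (\<phi> n)) = cnj (a n) * of_real (delta_weight \<tau> M n)"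
  shows "adjoint_l2 (\<lambda>f n. a n * f (\<phi> n)) (\<lambda>f n. a n * f (\<phi> n))"
  unfolding adjoint_l2_def
proof (intro ballI)
  fix f g assume "f \<in> l2_delta \<tau> M" "g \<in> l2_delta \<tau> M"
  have bij: "bij \<phi>" by (rule bij_betw_byWitness[where f' = \<phi>]) (use inv in auto)
  let ?F = "\<lambda>n. a n * f (\<phi> n) * cnj (g n) * of_real (delta_weight \<tau> M n)"
  have F: "?F (\<phi> n) = f n * cnj (a n * g (\<phi> n)) * of_real (delta_weight \<tau> M n)" for n
  proof -
    have "?F (\<phi> n) = (a (\<phi> n) * of_real (delta_weight \<tau> M (\<phi> n))) * f n * cnj (g (\<phi> n))"
      by (simp add: inv)
    then show ?thesis unfolding a by (simp add: mult_ac)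
  qed
  have "infsum ?F UNIV = (\<Sum>\<^sub>\<infinity>n. ?F (\<phi> n))"
    by (rule infsum_reindex_bij_betw[OF bij, of ?F, symmetric])
  then show "inner_delta \<tau> M (\<lambda>n. a n * f (\<phi> n)) g = inner_delta \<tau> M f (\<lambda>n. a n * g (\<phi> n))"
    unfolding inner_delta_def by (simp only: F)
qed

lemma adjoint_l2_T: "adjoint_l2 (diffrefl_T \<tau>) (diffrefl_T \<tau>)"
proof -
  let ?a = "\<lambda>n :: int. if n \<ge> 0 then \<tau> else inverse \<tau>"
  let ?b = "\<lambda>n :: int. if n \<ge> 0 then 0 else \<tau> - inverse \<tau>"
  \<comment> \<open>For n > 0 both sides agree since \<open>\<tau>\<^sup>2\<close> in the weight at
    -n cancels the coefficient 1/\<tau> there down to \<tau>.\<close>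
  have w: "?a (- n) * delta_weight \<tau> M (- n) = ?a n * delta_weight \<tau> M n" for n
    using delta_weight_neg[of M n \<tau>] delta_weight_neg[of M "- n" \<tau>] M_gt \<tau>_pos
    by (cases n "0 :: int" rule: linorder_cases) (simp_all add: power2_eq_square)
  have b: "bounded_l2 (\<lambda>f n. of_real (if n \<ge> 0 then c else d) * f n)" for c d :: real
    by (rule bounded_l2_multiplier[where B = "max \<bar>c\<bar> \<bar>d\<bar>"]) auto
  have "adjoint_l2 (\<lambda>f n. of_real (?a n) * f (- n)) (\<lambda>f n. of_real (?a n) * f (- n))"
    by (rule adjoint_l2_reindex) (simp, simp only: complex_cnj_complex_of_real w flip: of_real_mult)
  \<comment> \<open>Multiplication by a real function is the case of the identity as
    involution.\<close>
  moreover have "adjoint_l2 (\<lambda>f n. of_real (?b n) * f n) (\<lambda>f n. of_real (?b n) * f n)"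
    by (rule adjoint_l2_reindex[where \<phi> = "\<lambda>n. n"]) simp_all
  ultimately show ?thesis
    unfolding diffrefl_T_split[abs_def]
    by (rule adjoint_l2_add) (intro b bounded_l2_comp[OF b bounded_l2_flip])+
qed

lemma adjoint_l2_U: "adjoint_l2 (diffrefl_U M) (diffrefl_U M)"
proof -
  have "adjoint_l2 (\<lambda>f n. 1 * f (M - n)) (\<lambda>f n. 1 * f (M - n))"
    by (rule adjoint_l2_reindex) (use delta_weight_flip[of M \<tau>] M_gt in simp_all)
  then show ?thesis by (simp add: diffrefl_U_def[abs_def])
qed

lemma adjoint_l2_scale: "adjoint_l2 (\<lambda>f n. c * f n) (\<lambda>f n. cnj c * f n)"
  unfolding adjoint_l2_def inner_delta_def by (simp add: mult_ac)

section \<open>From the generators to the whole affine Hecke algebra\<close>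

lemma diffrefl_rep_gens:
  "diffrefl_rep \<tau> M (daha_T \<tau>) = diffrefl_T \<tau>" "diffrefl_rep \<tau> M (daha_U \<tau>) = diffrefl_U M"
  "diffrefl_rep \<tau> M (daha_scalar \<tau> c) = (\<lambda>f n. c * f n)"
  using is_diffrefl_rep_diffrefl_rep[of \<tau> M] \<tau>_pos
  by (simp_all add: is_diffrefl_rep_def hecke_rep_on_def fun_eq_iff)

lemma diffrefl_rep_hom:
  assumes "h \<in> affine_hecke \<tau>" "k \<in> affine_hecke \<tau>"
  shows "diffrefl_rep \<tau> M (h \<oplus>\<^bsub>daha \<tau>\<^esub> k) = (\<lambda>f n. diffrefl_rep \<tau> M h f n + diffrefl_rep \<tau> M k f n)"
    "diffrefl_rep \<tau> M (h \<otimes>\<^bsub>daha \<tau>\<^esub> k) = (\<lambda>f. diffrefl_rep \<tau> M h (diffrefl_rep \<tau> M k f))"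
  using is_diffrefl_rep_diffrefl_rep[of \<tau> M] \<tau>_pos assms
  by (simp_all add: is_diffrefl_rep_def hecke_rep_on_def fun_eq_iff)

lemma bounded_l2_diffrefl_rep: "h \<in> affine_hecke \<tau> \<Longrightarrow> bounded_l2 (diffrefl_rep \<tau> M h)"
proof (induction rule: affine_hecke_induct)
  case (scalar c)
  show ?case unfolding diffrefl_rep_gens by (rule bounded_l2_multiplier) (rule order_refl)
next
  case T
  show ?case unfolding diffrefl_rep_gens by (rule bounded_l2_T)
next
  case U
  show ?case unfolding diffrefl_rep_gens by (rule bounded_l2_U)
next
  case (add h k)
  then show ?case by (simp add: diffrefl_rep_hom bounded_l2_add)
next
  case (mult h k)
  then show ?case by (simp add: diffrefl_rep_hom bounded_l2_comp)
qed

lemma hecke_star_closed: "h \<in> affine_hecke \<tau> \<Longrightarrow> hecke_star \<tau> h \<in> affine_hecke \<tau>"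
  using is_hecke_star_hecke_star[of \<tau>] by (auto simp: is_hecke_star_def)

text \<open>Adjoints and the star both conjugate scalars and reverse products, and both fix T and U,
  so the property is inherited through sums and products; boundedness keeps every vector involved in
  the Hilbert space.\<close>

lemma adjoint_l2_diffrefl_rep:
  "h \<in> affine_hecke \<tau> \<Longrightarrow> adjoint_l2 (diffrefl_rep \<tau> M h) (diffrefl_rep \<tau> M (hecke_star \<tau> h))"
proof (induction rule: affine_hecke_induct)
  case (scalar c)
  show ?case unfolding is_hecke_star_gens[OF is_hecke_star_hecke_star] diffrefl_rep_gens
    by (rule adjoint_l2_scale)
next
  case T
  show ?case unfolding is_hecke_star_gens[OF is_hecke_star_hecke_star] diffrefl_rep_gens
    by (rule adjoint_l2_T)
next
  case U
  show ?case unfolding is_hecke_star_gens[OF is_hecke_star_hecke_star] diffrefl_rep_gens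
    by (rule adjoint_l2_U)
next
  case (add h k)
  have "hecke_star \<tau> (h \<oplus>\<^bsub>daha \<tau>\<^esub> k) = hecke_star \<tau> h \<oplus>\<^bsub>daha \<tau>\<^esub> hecke_star \<tau> k"
    using is_hecke_star_hecke_star[of \<tau>] add.hyps by (simp add: is_hecke_star_def)
  then show ?case
    using add by (simp add: diffrefl_rep_hom hecke_star_closed adjoint_l2_add bounded_l2_diffrefl_rep)
next
  case (mult h k)
  have "hecke_star \<tau> (h \<otimes>\<^bsub>daha \<tau>\<^esub> k) = hecke_star \<tau> k \<otimes>\<^bsub>daha \<tau>\<^esub> hecke_star \<tau> h"
    using is_hecke_star_hecke_star[of \<tau>] mult.hyps by (simp add: is_hecke_star_def)
  then show ?case
    using mult by (simp add: diffrefl_rep_hom hecke_star_closed adjoint_l2_comp bounded_l2_diffrefl_rep)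
qed

text \<open>The algebraic laws are inherited from all lattice functions, and invariance of the
  Hilbert space is part of boundedness.\<close>

lemma hecke_rep_on_l2: "hecke_rep_on \<tau> (l2_delta \<tau> M) (diffrefl_rep \<tau> M)"
  using is_diffrefl_rep_diffrefl_rep[of \<tau> M] \<tau>_pos bounded_l2_closed[OF bounded_l2_diffrefl_rep]
  unfolding is_diffrefl_rep_def hecke_rep_on_def by simp

end

theorem proposition5p1:
  fixes \<tau> :: real and M :: int
  assumes "0 < \<tau>" "\<tau> < 1" "M > 1"
  shows "hecke_rep_on \<tau> (l2_delta \<tau> M) (diffrefl_rep \<tau> M) \<and>
    (\<forall>h \<in> affine_hecke \<tau>. \<exists>C. \<forall>f \<in> l2_delta \<tau> M.
       norm_delta \<tau> M (diffrefl_rep \<tau> M h f) \<le> C * norm_delta \<tau> M f) \<and>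
    (\<forall>h \<in> affine_hecke \<tau>. \<forall>f \<in> l2_delta \<tau> M. \<forall>g \<in> l2_delta \<tau> M.
       inner_delta \<tau> M (diffrefl_rep \<tau> M h f) g = inner_delta \<tau> M f (diffrefl_rep \<tau> M (hecke_star \<tau> h) g))"
  using hecke_rep_on_l2[OF assms] bounded_l2_norm[OF assms bounded_l2_diffrefl_rep[OF assms]]
    adjoint_l2_diffrefl_rep[OF assms]
  unfolding adjoint_l2_def[OF assms] by blast

end
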